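(* A planar curve possesses the Harada self-affinity (HSA) if and only if it is either a line or a parabola.
   Context: Identify $\mathbb{C}$ with $\mathbb{R}^2$. A curve is a smooth map $\gamma:I\to\mathbb{C}$ on an interval $I\subset\mathbb{R}$ with nowhere vanishing derivative. $\mathrm{Aff}(\mathbb{C})$ denotes the group of real affine transformations $z\mapsto Az+b$ of $\mathbb{C}=\mathbb{R}^2$ ($A$ a real $2\times2$ matrix, $b\in\mathbb{C}$). HSA: a curve $\gamma:I\to\mathbb{C}$ possesses the Harada self-affinity if for any subinterval $J\subset I$ (homeomorphic to $I$) there exists a pair $(\sigma_J,F_J)$ of a reparametrization (smooth homeomorphism) $\sigma_J:I\to J$ and an affine map $F_J:z\mapsto A_Jz+b_J$ in $\mathrm{Aff}(\mathbb{C})$ such that $$\gamma(\sigma_J(t))=F_J\gamma(t)\quad\text{for all }t\in I.$$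
   Formalization: The formal equivalence adds that the curve's trace is bounded: HSA holds iff the curve is a bounded arc of a line or a parabola; an unbounded one fails, e.g. γ(t)=t on ℝ with J=(0,1). *)

theory Defs
  imports "HOL-Analysis.Analysis"
begin

text \<open>
  Intervals may be open, half-open or closed, bounded or not, but are not reduced to a point,
  so that derivatives \<open>at t within I\<close> (one-sided at an endpoint belonging to \<open>I\<close>) are unique.
\<close>

definition interval :: "real set \<Rightarrow> bool" where
  "interval I \<longleftrightarrow> is_interval I \<and> interior I \<noteq> {}"

text \<open>Smoothness is \<open>C\<^sup>\<infinity>\<close>: \<open>D n\<close> is the \<open>n\<close>-th derivative of \<open>f\<close> on \<open>I\<close>.\<close>

definition smooth_on_interval :: "real set \<Rightarrow> (real \<Rightarrow> 'a::real_normed_vector) \<Rightarrow> bool" where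
  "smooth_on_interval I f \<longleftrightarrow>
     (\<exists>D. (\<forall>t\<in>I. D 0 t = f t) \<and>
          (\<forall>n. \<forall>t\<in>I. (D n has_vector_derivative D (Suc n) t) (at t within I)))"

definition curve :: "real set \<Rightarrow> (real \<Rightarrow> complex) \<Rightarrow> bool" where
  "curve I \<gamma> \<longleftrightarrow> interval I \<and> smooth_on_interval I \<gamma> \<and>
     (\<forall>t\<in>I. vector_derivative \<gamma> (at t within I) \<noteq> 0)"

text \<open>
  On \<open>complex\<close> the predicate \<open>linear\<close> means real-linear, so \<open>A\<close> ranges over the real
  \<open>2 \<times> 2\<close> matrices; it is invertible because \<open>Aff\<close> is a group.
\<close>

definition Aff :: "(complex \<Rightarrow> complex) set" where
  "Aff = {F. \<exists>A b. linear A \<and> bij A \<and> F = (\<lambda>z. A z + b)}"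

definition reparametrization :: "real set \<Rightarrow> real set \<Rightarrow> (real \<Rightarrow> real) \<Rightarrow> bool" where
  "reparametrization I J \<sigma> \<longleftrightarrow>
     smooth_on_interval I \<sigma> \<and> (\<exists>\<tau>. homeomorphism I J \<sigma> \<tau>)"

text \<open>
  When \<open>I\<close> is not compact, \<open>J\<close> may be chosen with compact closure inside \<open>I\<close>; then
  \<open>\<gamma> ` J\<close> is bounded, and hence so is its affine image \<open>\<gamma> ` I\<close>. In particular a complete line or
  parabola, parametrized by \<open>UNIV\<close>, is not self-affine in this sense, but its bounded arcs are.
\<close>

definition harada_self_affine :: "real set \<Rightarrow> (real \<Rightarrow> complex) \<Rightarrow> bool" where
  "harada_self_affine I \<gamma> \<longleftrightarrow>
     (\<forall>J. J \<subseteq> I \<and> interval J \<and> J homeomorphic I \<longrightarrow>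
        (\<exists>\<sigma> F. reparametrization I J \<sigma> \<and> F \<in> Aff \<and> (\<forall>t\<in>I. \<gamma> (\<sigma> t) = F (\<gamma> t))))"

definition is_line :: "complex set \<Rightarrow> bool" where
  "is_line L \<longleftrightarrow> affine L \<and> aff_dim L = 1"

text \<open>A parabola is the locus of points equidistant from a focus \<open>f\<close> and a directrix \<open>L\<close>.\<close>

definition is_parabola :: "complex set \<Rightarrow> bool" where
  "is_parabola P \<longleftrightarrow> (\<exists>f L. is_line L \<and> f \<notin> L \<and> P = {z. dist z f = infdist z L})"

end

theory Submission
  imports Defs
begin

text \<open>
  At a point \<open>t\<^sub>0\<close> of nonzero curvature, self-affinity exhibits \<open>\<gamma> ` I\<close> as an affine image of the arc
  of \<open>\<gamma>\<close> over a copy of \<open>I\<close> of size \<open>\<epsilon>\<close> around \<open>t\<^sub>0\<close>. Rescaled by \<open>1 / \<epsilon>\<close> along the tangent and by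
  \<open>1 / \<epsilon>\<^sup>2\<close> along \<open>\<gamma>''\<close>, these arcs converge to an arc of a parabola. The affine maps from the rescaled
  arcs onto the bounded set \<open>\<gamma> ` I\<close> are bounded on three affinely independent points, so a
  subsequence converges, and \<open>\<gamma> ` I\<close> lies on an affine image, possibly degenerate, of the parabola.
  If the curvature vanishes identically, the curve is a segment. Conversely, on a line or parabola
  the abscissa parametrizes the curve, bounded intervals of the same topological type are related by
  an affine map of the abscissa, and every such map extends to an affine map of the plane
  preserving the parabola.
\<close>

subsection \<open>Normal forms of lines and parabolas\<close>

text \<open>With \<open>norm v = 1\<close>, the coordinates \<open>x\<close>, \<open>y\<close> in
  \<open>p + v * Complex x y\<close> are orthonormal, so distances to lines and points can be
  computed in them.\<close>

lemma is_line_iff: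
  "is_line L \<longleftrightarrow> (\<exists>p v. norm v = 1 \<and> L = range (\<lambda>x. p + v * Complex x 0))"
proof
  assume L: "is_line L"
  then have "affine L" and dim: "aff_dim L = 1"
    by (auto simp: is_line_def)
  have "L \<noteq> {}" using dim by auto
  then obtain p where p: "p \<in> L" by blast
  have "L \<noteq> {p}" using dim by auto
  then obtain q where q: "q \<in> L" "q \<noteq> p" using p by blast
  have "affine hull {p, q} = L"
  proof (rule affine_dim_equal)
    show "affine hull {p, q} \<subseteq> L"
      using p q \<open>affine L\<close> by (simp add: hull_minimal)
  qed (use dim q \<open>affine L\<close> in auto)
  then have L_eq: "L = range (\<lambda>u. p + u *\<^sub>R (q - p))"
    by (simp add: affine_hull_2_alt)
  define r where "r = norm (q - p)"
  have r: "r > 0" using q by (simp add: r_def)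
  define v where "v = (q - p) / of_real r"
  have qp: "u *\<^sub>R (q - p) = v * Complex (u * r) 0" for u
    using r by (simp add: v_def scaleR_conv_of_real flip: complex_of_real_def) 
  have "L = range (\<lambda>x. p + v * Complex x 0)"
    unfolding L_eq qp
  proof (intro equalityI subsetI)
    fix z assume "z \<in> range (\<lambda>x. p + v * Complex x 0)"
    then obtain x where "z = p + v * Complex x 0" by blast
    then have "z = p + v * Complex (x / r * r) 0" using r by simp
    then show "z \<in> range (\<lambda>u. p + v * Complex (u * r) 0)" by blast
  qed auto
  moreover have "norm v = 1" using r by (simp add: v_def r_def norm_divide)
  ultimately show "\<exists>p v. norm v = 1 \<and> L = range (\<lambda>x. p + v * Complex x 0)" by blast
next
  assume "\<exists>p v. norm v = 1 \<and> L = range (\<lambda>x. p + v * Complex x 0)"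
  then obtain p v where v: "norm v = 1" and "L = range (\<lambda>x. p + v * Complex x 0)" by blast
  then have "L = affine hull {p, p + v}"
    by (simp add: affine_hull_2_alt scaleR_conv_of_real mult.commute flip: complex_of_real_def)
  then show "is_line L"
    using v by (auto simp: is_line_def)
qed

lemma norm_ge_abs_Im_Complex: "\<bar>y\<bar> \<le> norm (Complex x y)"
  using abs_Im_le_cmod[of "Complex x y"] by simp

text \<open>Multiplication by \<open>v\<close> is a rotation, so the line is horizontal in the
  coordinates. The point with the same abscissa attains the value, and every other distance is at
  least the difference of ordinates.\<close>

lemma infdist_line:
  assumes "norm v = 1"
  shows "infdist (p + v * Complex x y) (range (\<lambda>x. p + v * Complex x h)) = \<bar>y - h\<bar>"
proof -
  have dist: "dist (p + v * Complex x y) (p + v * Complex x' h) = norm (Complex (x - x') (y - h))" for x'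
  proof -
    have "p + v * Complex x y - (p + v * Complex x' h) = v * Complex (x - x') (y - h)"
      by (simp add: complex_eq_iff algebra_simps)
    then show ?thesis using assms by (simp add: dist_norm norm_mult)
  qed
  show ?thesis
  proof (rule antisym)
    have "infdist (p + v * Complex x y) (range (\<lambda>x. p + v * Complex x h))
        \<le> dist (p + v * Complex x y) (p + v * Complex x h)"
      by (rule infdist_le) blast
    also have "\<dots> = \<bar>y - h\<bar>" unfolding dist by (simp add: cmod_def)
    finally show "infdist (p + v * Complex x y) (range (\<lambda>x. p + v * Complex x h)) \<le> \<bar>y - h\<bar>" .
    show "\<bar>y - h\<bar> \<le> infdist (p + v * Complex x y) (range (\<lambda>x. p + v * Complex x h))"
      unfolding infdist_def image_comp o_def
      by (auto simp: dist norm_ge_abs_Im_Complex simp del: dist_add_cancel intro!: cINF_greatest)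
  qed
qed

lemma rotated_coordinates:
  assumes "v \<noteq> 0"
  obtains x y where "z = p + v * Complex x y"
proof -
  obtain x y where "(z - p) / v = Complex x y" by (cases "(z - p) / v")
  then have "z = p + v * Complex x y" using assms by (simp add: field_simps)
  then show thesis using that by blast
qed

text \<open>The vertex is \<open>p\<close> and \<open>d\<close> is the signed focal distance.
  Equating squared distances gives x^2 = 4 d y; a negative \<open>d\<close> reverses the
  opening.\<close>

lemma focus_directrix_equation:
  assumes v: "norm v = 1" and d: "d \<noteq> 0"
  shows "{z. dist z (p + v * Complex 0 d) = infdist z (range (\<lambda>x. p + v * Complex x (- d)))}
    = range (\<lambda>x. p + v * Complex x (1 / (4 * d) * x\<^sup>2))" (is "?P = ?Q")
proof -
  have v0: "v \<noteq> 0" using v by auto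
  have mem: "p + v * Complex x y \<in> ?P \<longleftrightarrow> y = 1 / (4 * d) * x\<^sup>2" for x y
  proof -
    have "p + v * Complex x y - (p + v * Complex 0 d) = v * Complex x (y - d)"
      by (simp add: complex_eq_iff algebra_simps)
    then have "dist (p + v * Complex x y) (p + v * Complex 0 d) = sqrt (x\<^sup>2 + (y - d)\<^sup>2)"
      using v by (simp only: dist_norm norm_mult) (simp add: cmod_def)
    \<comment> \<open>The distance to the directrix, an absolute value, is written as a root of a
      square so that the roots on both sides cancel.\<close>
    then have "p + v * Complex x y \<in> ?P \<longleftrightarrow> sqrt (x\<^sup>2 + (y - d)\<^sup>2) = sqrt ((y + d)\<^sup>2)"
      using infdist_line[OF v, of p x y "- d"] by simp
    also have "\<dots> \<longleftrightarrow> x\<^sup>2 + (y - d)\<^sup>2 = (y + d)\<^sup>2"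
      by (simp only: real_sqrt_eq_iff)
    also have "\<dots> \<longleftrightarrow> y = 1 / (4 * d) * x\<^sup>2"
      using d by (auto simp: field_simps power2_eq_square)
    finally show ?thesis .
  qed
  show ?thesis
  proof (intro equalityI subsetI)
    fix z assume z: "z \<in> ?P"
    obtain x y where "z = p + v * Complex x y" using rotated_coordinates[OF v0] by blast
    then show "z \<in> ?Q" using z mem[of x y] by auto
  next
    fix z assume "z \<in> ?Q"
    then show "z \<in> ?P" using mem by blast
  qed
qed

text \<open>Admitting c = 0 lets the converse direction treat lines and parabolas together.\<close>

lemma line_or_parabola_normal_form:
  assumes "(\<exists>L. is_line L \<and> S \<subseteq> L) \<or> (\<exists>P. is_parabola P \<and> S \<subseteq> P)"
  obtains p v c where "v \<noteq> 0" "S \<subseteq> range (\<lambda>x. p + v * Complex x (c * x\<^sup>2))"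
  using assms
proof (elim disjE exE conjE)
  fix L assume "is_line L" and S: "S \<subseteq> L"
  then obtain p v where "norm v = 1" "L = range (\<lambda>x. p + v * Complex x 0)"
    by (auto simp: is_line_iff)
  moreover from this have "v \<noteq> 0" by auto
  ultimately show thesis using that[of v p 0] S by auto
next
  fix P assume "is_parabola P" and S: "S \<subseteq> P"
  then obtain f L where L: "is_line L" and fL: "f \<notin> L" and P: "P = {z. dist z f = infdist z L}"
    by (auto simp: is_parabola_def)
  obtain p v where v: "norm v = 1" and L_eq: "L = range (\<lambda>x. p + v * Complex x 0)"
    using L by (auto simp: is_line_iff)
  have v0: "v \<noteq> 0" using v by auto
  obtain x0 y0 where f: "f = p + v * Complex x0 y0"
    using rotated_coordinates[OF v0] by blast
  have y0: "y0 \<noteq> 0" using fL f L_eq by auto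
  \<comment> \<open>\<open>q\<close> is the vertex, halfway between the focus and its foot on the
    directrix, so \<open>y0 / 2\<close> is the signed focal distance.\<close>
  define q where "q = p + v * Complex x0 (y0 / 2)"
  have f': "f = q + v * Complex 0 (y0 / 2)"
    unfolding f q_def by (simp add: complex_eq_iff algebra_simps)
  have shift: "p + v * Complex x 0 = q + v * Complex (x - x0) (- (y0 / 2))" for x
    unfolding q_def by (simp add: complex_eq_iff algebra_simps)
  have "L = range (\<lambda>x. q + v * Complex x (- (y0 / 2)))"
    unfolding L_eq shift
  proof (intro equalityI subsetI)
    fix z assume "z \<in> range (\<lambda>x. q + v * Complex x (- (y0 / 2)))"
    then obtain x where "z = q + v * Complex (x + x0 - x0) (- (y0 / 2))" by auto
    then show "z \<in> range (\<lambda>x. q + v * Complex (x - x0) (- (y0 / 2)))" by blast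
  qed auto
  then have "P = range (\<lambda>x. q + v * Complex x (1 / (4 * (y0 / 2)) * x\<^sup>2))"
    unfolding P f' using focus_directrix_equation[OF v, of "y0 / 2" q] y0 by simp
  then show thesis using that v0 S by blast
qed

lemma normal_form_line_or_parabola:
  assumes v: "v \<noteq> 0" and S: "S \<subseteq> range (\<lambda>x. p + v * Complex x (c * x\<^sup>2))"
  shows "(\<exists>L. is_line L \<and> S \<subseteq> L) \<or> (\<exists>P. is_parabola P \<and> S \<subseteq> P)"
proof -
  define r where "r = norm v"
  define u where "u = v / of_real r"
  have r: "r > 0" using v by (simp add: r_def)
  have u: "norm u = 1" using v by (simp add: u_def r_def norm_divide)
  \<comment> \<open>Normalising \<open>v\<close> multiplies the abscissa by \<open>r\<close>, which
    divides the quadratic coefficient by \<open>r\<close>.\<close>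
  have vu: "v * Complex x (c * x\<^sup>2) = u * Complex (r * x) (c / r * (r * x)\<^sup>2)" for x
  proof -
    have "v * Complex x (c * x\<^sup>2) = u * (of_real r * Complex x (c * x\<^sup>2))"
      using r by (simp add: u_def)
    also have "of_real r * Complex x (c * x\<^sup>2) = Complex (r * x) (c / r * (r * x)\<^sup>2)"
      using r by (simp add: complex_eq_iff power2_eq_square)
    finally show ?thesis .
  qed
  have S': "S \<subseteq> range (\<lambda>x. p + u * Complex x (c / r * x\<^sup>2))"
    using S unfolding vu by blast
  show ?thesis
  proof (cases "c = 0")
    case True
    have "is_line (range (\<lambda>x. p + u * Complex x 0))"
      using u by (auto simp: is_line_iff)
    then show ?thesis using S' True by auto
  next
    case False
    \<comment> \<open>The focal distance is the solution of
      \<open>c / r = 1 / (4 * d)\<close>.\<close>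
    define d where "d = r / (4 * c)"
    have d: "d \<noteq> 0" using False r by (simp add: d_def)
    have cd: "c / r = 1 / (4 * d)" using False r by (simp add: d_def)
    define f where "f = p + u * Complex 0 d"
    define L where "L = range (\<lambda>x. p + u * Complex x (- d))"
    have "p + u * Complex x (- d) = (p + u * Complex 0 (- d)) + u * Complex x 0" for x
      by (simp add: complex_eq_iff algebra_simps)
    then have "L = range (\<lambda>x. (p + u * Complex 0 (- d)) + u * Complex x 0)"
      unfolding L_def by (intro image_cong refl)
    then have "is_line L"
      using u is_line_iff by blast
    moreover have "f \<notin> L"
    proof
      assume "f \<in> L"
      then obtain x where "u * Complex 0 d = u * Complex x (- d)"
        by (auto simp: f_def L_def)
      moreover have "u \<noteq> 0" using u by auto
      ultimately show False using d by simp
    qed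
    ultimately have "is_parabola {z. dist z f = infdist z L}"
      by (auto simp: is_parabola_def)
    moreover have "S \<subseteq> {z. dist z f = infdist z L}"
      using S' focus_directrix_equation[OF u d, of p] unfolding cd f_def L_def by simp
    ultimately show ?thesis by blast
  qed
qed

text \<open>The coefficients will arise as limits, so they may vanish or be parallel; the arc then
  degenerates to part of a line. Otherwise moving the parameter to the vertex makes velocity and
  axis orthogonal.\<close>

lemma quadratic_arc_line_or_parabola:
  fixes a b e :: complex
  assumes S: "S \<subseteq> range (\<lambda>x. e + x *\<^sub>R a + x\<^sup>2 *\<^sub>R b)"
  shows "(\<exists>L. is_line L \<and> S \<subseteq> L) \<or> (\<exists>P. is_parabola P \<and> S \<subseteq> P)"
proof -
  have line: ?thesis if "w \<noteq> 0" "\<And>z. z \<in> S \<Longrightarrow> \<exists>x. z = q + x *\<^sub>R w" for q w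
  proof (rule normal_form_line_or_parabola[of w _ q 0])
    have "x *\<^sub>R w = w * Complex x (0 * x\<^sup>2)" for x
      by (simp add: scaleR_conv_of_real flip: complex_of_real_def)
    then show "S \<subseteq> range (\<lambda>x. q + w * Complex x (0 * x\<^sup>2))"
      using that(2) by fastforce
  qed (fact that(1))
  show ?thesis
  proof (cases "b = 0")
    case True
    show ?thesis
    proof (cases "a = 0")
      case True
      \<comment> \<open>Here \<open>S\<close> is at most the point \<open>e\<close>, and the
        direction 1 is an arbitrary choice of line through it.\<close>
      then have "\<exists>x. z = e + x *\<^sub>R 1" if "z \<in> S" for z
        using S \<open>b = 0\<close> that by (intro exI[of _ 0]) auto
      then show ?thesis by (rule line[OF one_neq_zero])
    next
      case False
      show ?thesis
      proof (rule line[OF False, of e])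
        fix z assume "z \<in> S"
        then show "\<exists>x. z = e + x *\<^sub>R a" using S True by auto
      qed
    qed
  next
    case False
    \<comment> \<open>The vertex parameter \<open>s\<close> is chosen to make the velocity \<open>a'\<close> orthogonal to the axis \<open>b\<close>.\<close>
    define s where "s = - (a \<bullet> b) / (2 * (b \<bullet> b))"
    define a' where "a' = a + (2 * s) *\<^sub>R b"
    define e' where "e' = e + s *\<^sub>R a + s\<^sup>2 *\<^sub>R b"
    have orth: "a' \<bullet> b = 0"
      using False by (simp add: a'_def s_def inner_diff_left)
    have shift: "e + x *\<^sub>R a + x\<^sup>2 *\<^sub>R b = e' + (x - s) *\<^sub>R a' + (x - s)\<^sup>2 *\<^sub>R b" for x
      by (simp add: a'_def e'_def complex_eq_iff algebra_simps power2_eq_square)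
    show ?thesis
    proof (cases "a' = 0")
      \<comment> \<open>Now \<open>a\<close> and \<open>b\<close> are parallel, and the arc folds
        onto a ray of direction \<open>b\<close>.\<close>
      case True
      show ?thesis
      proof (rule line[OF False, of e'])
        fix z assume "z \<in> S"
        then obtain x where "z = e' + (x - s)\<^sup>2 *\<^sub>R b"
          using S shift True by auto
        then show "\<exists>x. z = e' + x *\<^sub>R b" by blast
      qed
    next
      case False
      \<comment> \<open>Orthogonality makes \<open>b / a'\<close> purely imaginary, so
        multiplication by \<open>a'\<close> carries the normal form with coefficient
        \<open>l\<close> to the arc.\<close>
      obtain k l where kl: "b / a' = Complex k l" by (cases "b / a'")
      have b: "b = a' * Complex k l" using False kl by (simp add: field_simps)
      have "k * (a' \<bullet> a') = a' \<bullet> b"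
        unfolding b by (simp add: inner_complex_def algebra_simps)
      then have k: "k = 0" using orth False by simp
      have "y *\<^sub>R a' + t *\<^sub>R b = a' * Complex y (l * t)" for y t
        unfolding b k by (simp add: complex_eq_iff)
      then have "e + x *\<^sub>R a + x\<^sup>2 *\<^sub>R b \<in> range (\<lambda>x. e' + a' * Complex x (l * x\<^sup>2))" for x
        by (subst shift, intro range_eqI[of _ _ "x - s"]) (simp add: add.assoc)
      then have "S \<subseteq> range (\<lambda>x. e' + a' * Complex x (l * x\<^sup>2))"
        using S by blast
      then show ?thesis by (rule normal_form_line_or_parabola[OF False])
    qed
  qed
qed

subsection \<open>Intervals and blow-up limits\<close>

lemma interval_iff:
  "interval I \<longleftrightarrow> is_interval I \<and> (\<exists>a\<in>I. \<exists>b\<in>I. a < b)"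
proof
  assume I: "interval I"
  then obtain x where "x \<in> interior I" by (auto simp: interval_def)
  then obtain d where d: "d > 0" "cball x d \<subseteq> I" by (auto simp: mem_interior_cball)
  have "x \<in> cball x d" "x + d \<in> cball x d" using d by (auto simp: dist_real_def)
  then have "\<exists>a\<in>I. \<exists>b\<in>I. a < b"
    using d by (intro bexI[of _ x] bexI[of _ "x + d"]) auto
  then show "is_interval I \<and> (\<exists>a\<in>I. \<exists>b\<in>I. a < b)"
    using I by (auto simp: interval_def)
next
  assume "is_interval I \<and> (\<exists>a\<in>I. \<exists>b\<in>I. a < b)"
  then obtain a b where I: "is_interval I" and ab: "a \<in> I" "b \<in> I" "a < b" by blast
  have "{a..b} \<subseteq> I" using mem_is_interval_1_I[OF I ab(1,2)] by auto
  then have "{a<..<b} \<subseteq> interior I"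
    using interior_mono[of "{a..b}" I] by simp
  moreover have "(a + b) / 2 \<in> {a<..<b}" using ab by auto
  ultimately show "interval I" using I by (auto simp: interval_def)
qed

lemma interval_injective_image:
  fixes f :: "real \<Rightarrow> real"
  assumes I: "interval I" and f: "continuous_on I f" "inj_on f I"
  shows "interval (f ` I)" "f ` I homeomorphic I"
proof -
  have I': "is_interval I" "connected I" "path_connected I"
    using I by (auto simp: interval_def is_interval_connected is_interval_path_connected)
  obtain a b where ab: "a \<in> I" "b \<in> I" "a < b" using I by (auto simp: interval_iff)
  then have "f a \<noteq> f b" using f by (auto simp: inj_on_def)
  then have "\<exists>a\<in>f ` I. \<exists>b\<in>f ` I. a < b"
    using ab by (metis imageI linorder_neqE)
  moreover have "is_interval (f ` I)"
    using I' f by (simp add: is_interval_connected_1 connected_continuous_image)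
  ultimately show "interval (f ` I)" by (simp add: interval_iff)
  show "f ` I homeomorphic I"
    using homeomorphism_into_1d[OF I'(3) f(1) refl f(2)] homeomorphic_def homeomorphic_sym by blast
qed

lemma interval_at_within_nontrivial:
  assumes "interval I" "t \<in> I"
  shows "at t within I \<noteq> bot"
proof -
  have "connected I" using assms by (auto simp: interval_def is_interval_connected)
  moreover have "I \<noteq> {t}" using assms by (force simp: interval_iff)
  ultimately have "t islimpt I" using connected_imp_perfect assms(2) by blast
  then show ?thesis by (simp add: trivial_limit_within)
qed

text \<open>A copy of \<open>I\<close> squeezed into the unit interval by the arctangent and centred at \<open>t\<^sub>0\<close>; its
  rescalings provide subintervals homeomorphic to \<open>I\<close> whatever the type of \<open>I\<close>.\<close>

lemma shrinking_subintervals: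
  assumes I: "interval I" and t0: "t0 \<in> interior I"
  obtains K h \<epsilon>0 where "K \<subseteq> {-1..1}" "0 < h" "{-h, 0, h} \<subseteq> K" "0 < \<epsilon>0" "{t0 - \<epsilon>0..t0 + \<epsilon>0} \<subseteq> I"
    "\<And>\<epsilon>. 0 < \<epsilon> \<Longrightarrow> \<epsilon> \<le> \<epsilon>0 \<Longrightarrow> (\<lambda>u. t0 + \<epsilon> * u) ` K \<subseteq> {t0 - \<epsilon>..t0 + \<epsilon>} \<and> interval ((\<lambda>u. t0 + \<epsilon> * u) ` K) \<and>
      (\<lambda>u. t0 + \<epsilon> * u) ` K homeomorphic I"
proof -
  \<comment> \<open>Half of the arctangent has modulus below pi / 4, hence below 1. As arctan is
    odd, points symmetric about \<open>t0\<close> give the symmetric nodes \<open>-h\<close> and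
    \<open>h\<close>.\<close>
  define \<psi> where "\<psi> t = arctan (t - t0) / 2" for t
  obtain d where d: "d > 0" "cball t0 d \<subseteq> I" using t0 by (auto simp: mem_interior_cball)
  have I_d: "{t0 - d..t0 + d} \<subseteq> I" using d by (simp add: cball_eq_atLeastAtMost)
  have \<psi>_bound: "\<psi> t \<in> {-1..1}" for t
    using arctan_bounded[of "t - t0"] pi_less_4 by (auto simp: \<psi>_def)
  have \<psi>_inj: "inj \<psi>" by (auto simp: inj_def \<psi>_def arctan_eq_iff)
  have \<psi>_cont: "continuous_on I \<psi>"
    unfolding \<psi>_def by (intro continuous_intros) auto
  define h where "h = arctan d / 2"
  have "- h = \<psi> (t0 - d)" "0 = \<psi> t0" "h = \<psi> (t0 + d)"
    by (auto simp: h_def \<psi>_def arctan_minus)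
  moreover have "t0 - d \<in> I" "t0 \<in> I" "t0 + d \<in> I" using I_d d by auto
  ultimately have "{-h, 0, h} \<subseteq> \<psi> ` I" by blast
  moreover have "(\<lambda>u. t0 + \<epsilon> * u) ` (\<psi> ` I) \<subseteq> {t0 - \<epsilon>..t0 + \<epsilon>} \<and> interval ((\<lambda>u. t0 + \<epsilon> * u) ` (\<psi> ` I)) \<and>
      (\<lambda>u. t0 + \<epsilon> * u) ` (\<psi> ` I) homeomorphic I" if "0 < \<epsilon>" "\<epsilon> \<le> d" for \<epsilon>
  proof (intro conjI)
    show "(\<lambda>u. t0 + \<epsilon> * u) ` (\<psi> ` I) \<subseteq> {t0 - \<epsilon>..t0 + \<epsilon>}"
    proof -
      have "t0 + \<epsilon> * \<psi> t \<in> {t0 - \<epsilon>..t0 + \<epsilon>}" for t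
        using \<psi>_bound[of t] that mult_left_mono[of "-1" "\<psi> t" \<epsilon>] mult_left_mono[of "\<psi> t" 1 \<epsilon>] by auto
      then show ?thesis by blast
    qed
    have cont: "continuous_on I (\<lambda>t. t0 + \<epsilon> * \<psi> t)"
      using \<psi>_cont by (intro continuous_intros)
    have inj: "inj_on (\<lambda>t. t0 + \<epsilon> * \<psi> t) I"
      using that \<psi>_inj by (auto simp: inj_def inj_on_def)
    show "interval ((\<lambda>u. t0 + \<epsilon> * u) ` (\<psi> ` I))" "(\<lambda>u. t0 + \<epsilon> * u) ` (\<psi> ` I) homeomorphic I"
      using interval_injective_image[OF I cont inj] by (simp_all add: image_image)
  qed
  moreover have "\<psi> ` I \<subseteq> {-1..1}" using \<psi>_bound by blast
  moreover have "0 < h" using d by (simp add: h_def)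
  ultimately show thesis using that[of "\<psi> ` I" h d] d I_d by simp
qed

text \<open>Inverting the affine map turns self-affinity around: the whole curve becomes an affine
  image of an arbitrarily small arc.\<close>

lemma self_affine_rescaling:
  assumes "harada_self_affine I \<gamma>" "J \<subseteq> I" "interval J" "J homeomorphic I"
  obtains B b where "linear B" "\<gamma> ` I = (\<lambda>t. B (\<gamma> t - b)) ` J"
proof -
  obtain \<sigma> F where \<sigma>: "reparametrization I J \<sigma>" and F: "F \<in> Aff" "\<forall>t\<in>I. \<gamma> (\<sigma> t) = F (\<gamma> t)"
    using assms unfolding harada_self_affine_def by blast
  obtain A b where A: "linear A" "bij A" and F_eq: "F = (\<lambda>z. A z + b)"
    using F by (auto simp: Aff_def)
  have "linear (inv A)"
    using A by (simp add: bij_is_inj inj_linear_imp_inv_linear)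
  have "\<sigma> ` I = J" using \<sigma> by (auto simp: reparametrization_def homeomorphism_def)
  have "inv A (\<gamma> (\<sigma> t) - b) = \<gamma> t" if "t \<in> I" for t
    using F F_eq A that by (simp add: bij_is_inj)
  then have "\<gamma> ` I = (\<lambda>t. inv A (\<gamma> t - b)) ` (\<sigma> ` I)"
    by (force simp: image_image)
  then show thesis using that \<open>linear (inv A)\<close> \<open>\<sigma> ` I = J\<close> by blast
qed

text \<open>First and second differences at the nodes \<open>-h\<close>, \<open>0\<close>,
  \<open>h\<close> nearly isolate \<open>a\<close> and \<open>b\<close>. Boundedness of
  \<open>S\<close> therefore bounds all coefficients uniformly, and compactness supplies a limiting
  quadratic.\<close>

lemma quadratic_limit:
  fixes S :: "'a::euclidean_space set"
  assumes S: "bounded S" and h: "0 < h" "{-h, 0, h} \<subseteq> K" and K: "K \<subseteq> {-1..1}"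
    and approx: "\<And>\<delta>. \<delta> > 0 \<Longrightarrow> \<exists>a b e \<xi> \<eta>. (\<forall>u\<in>K. \<bar>\<xi> u - u\<bar> \<le> \<delta> \<and> \<bar>\<eta> u - u\<^sup>2\<bar> \<le> \<delta>) \<and>
      S = (\<lambda>u. e + \<xi> u *\<^sub>R a + \<eta> u *\<^sub>R b) ` K"
  obtains a b e where "S \<subseteq> range (\<lambda>x::real. e + x *\<^sub>R a + x\<^sup>2 *\<^sub>R b)"
proof -
  obtain M where M: "\<And>z. z \<in> S \<Longrightarrow> norm z \<le> M" using S by (auto simp: bounded_iff)
  \<comment> \<open>The errors tend to 0 and never exceed \<open>h\<^sup>2 / 8\<close>, which keeps
    the node differences of \<open>\<xi>\<close> and \<open>\<eta>\<close> bounded away from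
    0.\<close>
  define \<delta> where "\<delta> n = h\<^sup>2 / 8 / real (Suc n)" for n
  have \<delta>_pos: "\<delta> n > 0" for n using h by (simp add: \<delta>_def)
  define approximates where "approximates n a b e \<xi> \<eta> \<longleftrightarrow>
    (\<forall>u\<in>K. \<bar>\<xi> u - u\<bar> \<le> \<delta> n \<and> \<bar>\<eta> u - u\<^sup>2\<bar> \<le> \<delta> n) \<and> S = (\<lambda>u. e + \<xi> u *\<^sub>R a + \<eta> u *\<^sub>R b) ` K"
    for n and a b e :: 'a and \<xi> \<eta> :: "real \<Rightarrow> real"
  have "\<forall>n. \<exists>a b e \<xi> \<eta>. approximates n a b e \<xi> \<eta>"
    unfolding approximates_def using approx \<delta>_pos by blast
  then obtain a b e \<xi> \<eta> where approximates: "\<And>n. approximates n (a n) (b n) (e n) (\<xi> n) (\<eta> n)"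
    by metis
  have \<xi>: "\<And>n u. u \<in> K \<Longrightarrow> \<bar>\<xi> n u - u\<bar> \<le> \<delta> n" and \<eta>: "\<And>n u. u \<in> K \<Longrightarrow> \<bar>\<eta> n u - u\<^sup>2\<bar> \<le> \<delta> n"
    and S_eq: "\<And>n. S = (\<lambda>u. e n + \<xi> n u *\<^sub>R a n + \<eta> n u *\<^sub>R b n) ` K"
    using approximates unfolding approximates_def by blast+
  have h1: "h \<le> 1" using h K by auto
  have hh: "h\<^sup>2 \<le> h" using h h1 by (simp add: power2_eq_square mult_left_le)
  have bnd: "norm (a n) \<le> 6 * M / h \<and> norm (b n) \<le> 6 * M / h\<^sup>2 \<and> norm (e n) \<le> M + 6 * M / h + 6 * M / h\<^sup>2" for n
  proof -
    define p where "p u = e n + \<xi> n u *\<^sub>R a n + \<eta> n u *\<^sub>R b n" for u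
    have "p u \<in> S" if "u \<in> K" for u
      using S_eq[of n] that unfolding p_def by blast
    then have p: "norm (p h) \<le> M" "norm (p (- h)) \<le> M" "norm (p 0) \<le> M"
      using M h by auto
    have "h\<^sup>2 / 8 / real (Suc n) \<le> h\<^sup>2 / 8 / 1"
      by (intro divide_left_mono) auto
    then have \<delta>: "\<delta> n \<le> h\<^sup>2 / 8" by (simp add: \<delta>_def)
    have \<xi>': "\<bar>\<xi> n h - h\<bar> \<le> h\<^sup>2 / 8" "\<bar>\<xi> n (- h) + h\<bar> \<le> h\<^sup>2 / 8" "\<bar>\<xi> n 0\<bar> \<le> h\<^sup>2 / 8"
      using \<xi>[of h n] \<xi>[of "- h" n] \<xi>[of 0 n] h \<delta> by auto
    have \<eta>': "\<bar>\<eta> n h - h\<^sup>2\<bar> \<le> h\<^sup>2 / 8" "\<bar>\<eta> n (- h) - h\<^sup>2\<bar> \<le> h\<^sup>2 / 8" "\<bar>\<eta> n 0\<bar> \<le> h\<^sup>2 / 8"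
      using \<eta>[of h n] \<eta>[of "- h" n] \<eta>[of 0 n] h \<delta> by auto
    define A where "A = norm (a n)"
    define B where "B = norm (b n)"
    have AB: "A \<ge> 0" "B \<ge> 0" by (auto simp: A_def B_def)
    \<comment> \<open>The first difference removes \<open>e n\<close>; its coefficient of
      \<open>a n\<close> is at least 7/4 h, and that of \<open>b n\<close> is at most h^2 /
      4.\<close>
    have "p h - p (- h) = (\<xi> n h - \<xi> n (- h)) *\<^sub>R a n + (\<eta> n h - \<eta> n (- h)) *\<^sub>R b n"
      by (simp add: p_def algebra_simps)
    then have 1: "(\<xi> n h - \<xi> n (- h)) *\<^sub>R a n = p h - p (- h) - (\<eta> n h - \<eta> n (- h)) *\<^sub>R b n"
      by simp
    have "norm ((\<xi> n h - \<xi> n (- h)) *\<^sub>R a n) \<le> 2 * M + \<bar>\<eta> n h - \<eta> n (- h)\<bar> * B"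
      unfolding 1 B_def
      using p norm_triangle_ineq4[of "p h - p (- h)" "(\<eta> n h - \<eta> n (- h)) *\<^sub>R b n"]
        norm_triangle_ineq4[of "p h" "p (- h)"] by simp
    also have "\<dots> \<le> 2 * M + h\<^sup>2 / 4 * B"
      using \<eta>' AB by (intro add_left_mono mult_right_mono) linarith+
    finally have "\<bar>\<xi> n h - \<xi> n (- h)\<bar> * A \<le> 2 * M + h\<^sup>2 / 4 * B" by (simp add: A_def)
    moreover have "(7 / 4 * h) * A \<le> \<bar>\<xi> n h - \<xi> n (- h)\<bar> * A"
      using \<xi>' hh AB by (intro mult_right_mono) linarith+
    ultimately have I1: "7 / 4 * (h * A) \<le> 2 * M + (h\<^sup>2 * B) / 4" by simp
    \<comment> \<open>The second difference has coefficient at least 3/2 h^2 on \<open>b n\<close>,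
      while only errors of at most h^2 / 2 remain on \<open>a n\<close>.\<close>
    have "p h + p (- h) - 2 *\<^sub>R p 0 = (\<xi> n h + \<xi> n (- h) - 2 * \<xi> n 0) *\<^sub>R a n
        + (\<eta> n h + \<eta> n (- h) - 2 * \<eta> n 0) *\<^sub>R b n"
      by (simp add: p_def algebra_simps scaleR_2)
    then have 2: "(\<eta> n h + \<eta> n (- h) - 2 * \<eta> n 0) *\<^sub>R b n
      = p h + p (- h) - 2 *\<^sub>R p 0 - (\<xi> n h + \<xi> n (- h) - 2 * \<xi> n 0) *\<^sub>R a n"
      by simp
    have "norm ((\<eta> n h + \<eta> n (- h) - 2 * \<eta> n 0) *\<^sub>R b n)
        \<le> 4 * M + \<bar>\<xi> n h + \<xi> n (- h) - 2 * \<xi> n 0\<bar> * A"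
      unfolding 2 A_def
      using p norm_triangle_ineq4[of "p h + p (- h) - 2 *\<^sub>R p 0"
          "(\<xi> n h + \<xi> n (- h) - 2 * \<xi> n 0) *\<^sub>R a n"]
        norm_triangle_ineq4[of "p h + p (- h)" "2 *\<^sub>R p 0"] norm_triangle_ineq[of "p h" "p (- h)"]
      by simp
    also have "\<dots> \<le> 4 * M + (h\<^sup>2 / 2) * A"
      using \<xi>' AB by (intro add_left_mono mult_right_mono) linarith+
    also have "(h\<^sup>2 / 2) * A \<le> (h / 2) * A" using hh AB by (intro mult_right_mono) auto
    finally have "\<bar>\<eta> n h + \<eta> n (- h) - 2 * \<eta> n 0\<bar> * B \<le> 4 * M + (h / 2) * A"
      by (simp add: B_def)
    moreover have "(3 / 2 * h\<^sup>2) * B \<le> \<bar>\<eta> n h + \<eta> n (- h) - 2 * \<eta> n 0\<bar> * B"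
      using \<eta>' AB by (intro mult_right_mono) linarith+
    ultimately have I2: "3 / 2 * (h\<^sup>2 * B) \<le> 4 * M + (h * A) / 2" by simp
    have pos: "0 \<le> h * A" "0 \<le> h\<^sup>2 * B" using h AB by auto
    \<comment> \<open>\<open>I1\<close> and \<open>I2\<close> bound each of \<open>h * A\<close> and
      \<open>h\<^sup>2 * B\<close> by a multiple of \<open>M\<close> plus a small fraction of the
      other. Solving this system gives bounds below 6 M.\<close>
    have "h * A \<le> 6 * M" "h\<^sup>2 * B \<le> 6 * M" using I1 I2 pos by auto
    then have A: "A \<le> 6 * M / h" and B: "B \<le> 6 * M / h\<^sup>2"
      using h by (simp_all add: field_simps)
    have "e n = p 0 - \<xi> n 0 *\<^sub>R a n - \<eta> n 0 *\<^sub>R b n" by (simp add: p_def)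
    then have "norm (e n) \<le> norm (p 0) + \<bar>\<xi> n 0\<bar> * A + \<bar>\<eta> n 0\<bar> * B"
      using norm_triangle_ineq4[of "p 0 - \<xi> n 0 *\<^sub>R a n" "\<eta> n 0 *\<^sub>R b n"]
        norm_triangle_ineq4[of "p 0" "\<xi> n 0 *\<^sub>R a n"] by (simp add: A_def B_def)
    also have "\<dots> \<le> M + 1 * A + 1 * B"
      using p \<xi>'(3) \<eta>'(3) hh h1 AB by (intro add_mono mult_right_mono) linarith+
    finally show ?thesis using A B by (simp add: A_def B_def)
  qed
  have "bounded (range (\<lambda>n. (a n, b n, e n)))"
  proof -
    have "range (\<lambda>n. (a n, b n, e n)) \<subseteq> range a \<times> range b \<times> range e" by auto
    moreover have "bounded (range a)" "bounded (range b)" "bounded (range e)"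
      using bnd by (auto simp: bounded_iff)
    ultimately show ?thesis by (intro bounded_subset[OF _ \<open>range (\<lambda>n. (a n, b n, e n)) \<subseteq> _\<close>] bounded_Times)
  qed
  from bounded_imp_convergent_subsequence[OF this] obtain l r
    where r: "strict_mono r" and lim: "((\<lambda>n. (a n, b n, e n)) \<circ> r) \<longlonglongrightarrow> l"
    by blast
  obtain a0 b0 e0 where l: "l = (a0, b0, e0)" by (cases l)
  have a0: "(\<lambda>n. a (r n)) \<longlonglongrightarrow> a0" and b0: "(\<lambda>n. b (r n)) \<longlonglongrightarrow> b0" and e0: "(\<lambda>n. e (r n)) \<longlonglongrightarrow> e0"
    using tendsto_fst[OF lim] tendsto_snd[OF lim] tendsto_fst[OF tendsto_snd[OF lim]]
      tendsto_snd[OF tendsto_snd[OF lim]] by (simp_all add: l o_def)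
  have \<delta>0: "\<delta> \<longlonglongrightarrow> 0"
    unfolding \<delta>_def divide_inverse[of _ "real _"]
    by (rule tendsto_mult_right_zero[OF LIMSEQ_inverse_real_of_nat])
  have "S \<subseteq> range (\<lambda>x::real. e0 + x *\<^sub>R a0 + x\<^sup>2 *\<^sub>R b0)"
  proof
    \<comment> \<open>The point stays fixed while its parameter varies with \<open>n\<close>.
      \<open>K\<close> may fail to be closed, so the limit \<open>x\<close> need not lie in
      \<open>K\<close>; hence the conclusion ranges over all reals.\<close>
    fix y assume "y \<in> S"
    then have "\<forall>n. \<exists>u\<in>K. y = e n + \<xi> n u *\<^sub>R a n + \<eta> n u *\<^sub>R b n"
      using S_eq by (intro allI) (auto simp only: image_iff)
    then obtain u where u: "\<And>n. u n \<in> K" "\<And>n. y = e n + \<xi> n (u n) *\<^sub>R a n + \<eta> n (u n) *\<^sub>R b n"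
      by metis
    have "bounded (range (\<lambda>n. u (r n)))"
      using u(1) K by (intro bounded_subset[OF bounded_closed_interval[of "-1" 1]]) auto
    from bounded_imp_convergent_subsequence[OF this] obtain x s
      where s: "strict_mono s" and x: "((\<lambda>n. u (r n)) \<circ> s) \<longlonglongrightarrow> x"
      by blast
    define q where "q n = r (s n)" for n
    have q: "strict_mono q" using r s by (simp add: q_def strict_mono_def)
    have x: "(\<lambda>n. u (q n)) \<longlonglongrightarrow> x" using x by (simp add: o_def q_def)
    have \<delta>q: "(\<lambda>n. \<delta> (q n)) \<longlonglongrightarrow> 0"
      using LIMSEQ_subseq_LIMSEQ[OF \<delta>0 q] by (simp add: o_def)
    have "(\<lambda>n. \<xi> (q n) (u (q n)) - u (q n)) \<longlonglongrightarrow> 0"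
      by (rule Lim_null_comparison[OF _ \<delta>q]) (use \<xi> u in auto)
    then have \<xi>x: "(\<lambda>n. \<xi> (q n) (u (q n))) \<longlonglongrightarrow> x"
      using tendsto_add[OF _ x] by force
    have "(\<lambda>n. \<eta> (q n) (u (q n)) - (u (q n))\<^sup>2) \<longlonglongrightarrow> 0"
      by (rule Lim_null_comparison[OF _ \<delta>q]) (use \<eta> u in auto)
    then have \<eta>x: "(\<lambda>n. \<eta> (q n) (u (q n))) \<longlonglongrightarrow> x\<^sup>2"
      using tendsto_add[OF _ tendsto_power[OF x, of 2]] by force
    have "(\<lambda>n. e (q n) + \<xi> (q n) (u (q n)) *\<^sub>R a (q n) + \<eta> (q n) (u (q n)) *\<^sub>R b (q n))
        \<longlonglongrightarrow> e0 + x *\<^sub>R a0 + x\<^sup>2 *\<^sub>R b0"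
      using LIMSEQ_subseq_LIMSEQ[OF a0 s] LIMSEQ_subseq_LIMSEQ[OF b0 s] LIMSEQ_subseq_LIMSEQ[OF e0 s]
      by (intro tendsto_intros \<xi>x \<eta>x) (simp_all add: q_def o_def)
    then have "(\<lambda>n::nat. y) \<longlonglongrightarrow> e0 + x *\<^sub>R a0 + x\<^sup>2 *\<^sub>R b0"
      using u(2) by simp
    then have "y = e0 + x *\<^sub>R a0 + x\<^sup>2 *\<^sub>R b0" by (simp add: LIMSEQ_const_iff)
    then show "y \<in> range (\<lambda>x::real. e0 + x *\<^sub>R a0 + x\<^sup>2 *\<^sub>R b0)" by blast
  qed
  then show thesis using that by blast
qed

section \<open>Second-order Taylor estimate within an interval\<close>

text \<open>The remainder \<open>R\<close> has derivative g'(s) - g'(t0) - (s - t0) g'', of norm at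
  most \<delta> |s - t0| near \<open>t0\<close>. The mean value inequality on the segment from
  \<open>t0\<close> to \<open>t\<close> then needs no second derivative away from
  \<open>t0\<close>.\<close>

lemma taylor_second_order:
  fixes g :: "real \<Rightarrow> 'a::real_normed_vector"
  assumes I: "is_interval I" and t0: "t0 \<in> I" and "\<delta> > 0"
    and g: "\<And>t. t \<in> I \<Longrightarrow> (g has_vector_derivative g' t) (at t within I)"
    and g': "(g' has_vector_derivative g'') (at t0 within I)"
  obtains d where "d > 0" "\<And>t. t \<in> I \<Longrightarrow> \<bar>t - t0\<bar> < d \<Longrightarrow>
    norm (g t - g t0 - (t - t0) *\<^sub>R g' t0 - ((t - t0)\<^sup>2 / 2) *\<^sub>R g'') \<le> \<delta> * (t - t0)\<^sup>2"
proof -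
  obtain d where d: "d > 0" and
    g'_lin: "\<And>t. t \<in> I \<Longrightarrow> \<bar>t - t0\<bar> < d \<Longrightarrow> norm (g' t - g' t0 - (t - t0) *\<^sub>R g'') \<le> \<delta> * \<bar>t - t0\<bar>"
    using g' \<open>\<delta> > 0\<close> unfolding has_vector_derivative_def has_derivative_within_alt by fastforce
  have sq: "((\<lambda>t. (t - t0)\<^sup>2 / 2) has_derivative (\<lambda>h. h * (s - t0))) (at s within X)" for s X
    by (auto intro!: derivative_eq_intros simp: fun_eq_iff field_simps)
  have lin: "((\<lambda>t. (t - t0) *\<^sub>R z) has_derivative (\<lambda>h. h *\<^sub>R z)) (at s within X)" for s X and z :: 'a
    by (auto intro!: derivative_eq_intros)
  define R where "R t = g t - (t - t0) *\<^sub>R g' t0 - ((t - t0)\<^sup>2 / 2) *\<^sub>R g''" for t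
  have "norm (g t - g t0 - (t - t0) *\<^sub>R g' t0 - ((t - t0)\<^sup>2 / 2) *\<^sub>R g'') \<le> \<delta> * (t - t0)\<^sup>2"
    if t: "t \<in> I" "\<bar>t - t0\<bar> < d" for t
  proof -
    let ?X = "closed_segment t0 t"
    have X: "s \<in> I" "\<bar>s - t0\<bar> \<le> \<bar>t - t0\<bar>" if "s \<in> ?X" for s
    proof -
      show "\<bar>s - t0\<bar> \<le> \<bar>t - t0\<bar>" using that by (auto simp: closed_segment_eq_real_ivl split: if_splits)
      show "s \<in> I" using that t t0 I
        by (meson closed_segment_subset in_mono is_interval_convex)
    qed
    have "norm (R t - R t0) \<le> \<delta> * \<bar>t - t0\<bar> * norm (t - t0)"
    proof (rule differentiable_bound[where S = ?X and f' = "\<lambda>s h. h *\<^sub>R (g' s - g' t0 - (s - t0) *\<^sub>R g'')"])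
      fix s assume s: "s \<in> ?X"
      have "(g has_vector_derivative g' s) (at s within ?X)"
        using g[of s] X s by (meson has_vector_derivative_within_subset subsetI)
      then show "(R has_derivative (\<lambda>h. h *\<^sub>R (g' s - g' t0 - (s - t0) *\<^sub>R g''))) (at s within ?X)"
        unfolding R_def has_vector_derivative_def
        by (rule has_derivative_eq_rhs[OF has_derivative_diff[OF has_derivative_diff[OF _ lin] has_derivative_scaleR_left[OF sq]]])
          (auto simp: algebra_simps)
      have "norm (g' s - g' t0 - (s - t0) *\<^sub>R g'') \<le> \<delta> * \<bar>t - t0\<bar>"
        using g'_lin[of s] X[OF s] t \<open>\<delta> > 0\<close> by (smt (verit) mult_left_mono)
      then show "onorm (\<lambda>h. h *\<^sub>R (g' s - g' t0 - (s - t0) *\<^sub>R g'')) \<le> \<delta> * \<bar>t - t0\<bar>"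
        using onorm_scaleR_left[OF bounded_linear_ident, of "g' s - g' t0 - (s - t0) *\<^sub>R g''"]
        by (simp add: onorm_id)
    qed auto
    then show ?thesis by (simp add: R_def power2_eq_square algebra_simps flip: abs_mult)
  qed
  then show thesis using that d by blast
qed

subsection \<open>Self-affine curves are arcs of lines or parabolas\<close>

lemma curve_derivatives:
  assumes "curve I \<gamma>"
  obtains D where "\<And>t. t \<in> I \<Longrightarrow> D 0 t = \<gamma> t"
    "\<And>n t. t \<in> I \<Longrightarrow> (D n has_vector_derivative D (Suc n) t) (at t within I)"
    "\<And>t. t \<in> I \<Longrightarrow> D 1 t \<noteq> 0"
proof -
  obtain D where D0: "\<And>t. t \<in> I \<Longrightarrow> D 0 t = \<gamma> t"
    and D: "\<And>n t. t \<in> I \<Longrightarrow> (D n has_vector_derivative D (Suc n) t) (at t within I)"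
    using assms unfolding curve_def smooth_on_interval_def by metis
  have "D 1 t \<noteq> 0" if t: "t \<in> I" for t
  proof -
    have "(\<gamma> has_vector_derivative D 1 t) (at t within I)"
      using has_vector_derivative_transform[OF t _ D[OF t, of 0], of \<gamma>] D0 by simp
    moreover have "at t within I \<noteq> bot"
      using assms t interval_at_within_nontrivial by (auto simp: curve_def)
    ultimately have "vector_derivative \<gamma> (at t within I) = D 1 t"
      by (simp add: vector_derivative_within)
    then show ?thesis using assms t by (auto simp: curve_def)
  qed
  then show thesis using that D0 D by blast
qed

text \<open>The quotient \<open>g' / cnj g'\<close> forgets the speed and retains the direction up
  to sign, so its constancy confines the curve to a line without any change to arc length.\<close>

lemma zero_curvature_imp_segment:
  fixes g g' g'' :: "real \<Rightarrow> complex"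
  assumes I: "is_interval I" and t0: "t0 \<in> I"
    and g: "\<And>t. t \<in> I \<Longrightarrow> (g has_vector_derivative g' t) (at t within I)"
    and g': "\<And>t. t \<in> I \<Longrightarrow> (g' has_vector_derivative g'' t) (at t within I)"
    and nz: "\<And>t. t \<in> I \<Longrightarrow> g' t \<noteq> 0"
    and curv: "\<And>t. t \<in> I \<Longrightarrow> Im (cnj (g' t) * g'' t) = 0"
  shows "g ` I \<subseteq> range (\<lambda>x. g t0 + x *\<^sub>R g' t0)"
proof -
  have conv: "convex I" using I by (rule is_interval_convex)
  \<comment> \<open>The direction of \<open>g'\<close> is constant because \<open>g' / cnj g'\<close> has derivative \<open>2 \<i> Im (cnj g' g'') / (cnj g')\<^sup>2\<close>.\<close>
  have "\<exists>w. \<forall>t\<in>I. g' t / cnj (g' t) = w"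
  proof (rule has_derivative_zero_constant[OF conv])
    fix t assume t: "t \<in> I"
    have "cnj (g' t) * g'' t = g' t * cnj (g'' t)"
      using curv[OF t] by (simp add: complex_eq_iff algebra_simps)
    then have eq: "g'' t * cnj (g' t) - g' t * cnj (g'' t) = 0" by (simp add: mult.commute)
    have "((\<lambda>t. cnj (g' t)) has_vector_derivative cnj (g'' t)) (at t within I)"
      by (rule bounded_linear.has_vector_derivative[OF bounded_linear_cnj g'[OF t]])
    then have "((\<lambda>t. g' t / cnj (g' t)) has_derivative
        (\<lambda>h. ((h *\<^sub>R g'' t) * cnj (g' t) - g' t * (h *\<^sub>R cnj (g'' t))) / (cnj (g' t) * cnj (g' t)))) (at t within I)"
      using g'[OF t] nz[OF t] unfolding has_vector_derivative_def
      by (intro has_derivative_divide') auto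
    also have "(\<lambda>h. ((h *\<^sub>R g'' t) * cnj (g' t) - g' t * (h *\<^sub>R cnj (g'' t))) / (cnj (g' t) * cnj (g' t))) = (\<lambda>h. 0)"
      using eq by (simp add: fun_eq_iff flip: scaleR_diff_right)
    finally show "((\<lambda>t. g' t / cnj (g' t)) has_derivative (\<lambda>h. 0)) (at t within I)" .
  qed
  then obtain w where w: "\<And>t. t \<in> I \<Longrightarrow> g' t / cnj (g' t) = w" by blast
  have g'_w: "g' t = w * cnj (g' t)" if "t \<in> I" for t
    using w[OF that] nz[OF that] by (auto simp: field_simps)
  \<comment> \<open>Integrating \<open>g' = w * cnj g'\<close>: every chord is fixed by the
    reflection that sends z to w cnj z.\<close>
  have "\<exists>c. \<forall>t\<in>I. g t - w * cnj (g t) = c"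
  proof (rule has_derivative_zero_constant[OF conv])
    fix t assume t: "t \<in> I"
    have "((\<lambda>t. g t - w * cnj (g t)) has_vector_derivative g' t - w * cnj (g' t)) (at t within I)"
      using g[OF t] bounded_linear.has_vector_derivative[OF bounded_linear_cnj g[OF t]]
      by (intro has_vector_derivative_diff has_vector_derivative_mult_right)
    then show "((\<lambda>t. g t - w * cnj (g t)) has_derivative (\<lambda>h. 0)) (at t within I)"
      using g'_w[OF t] by (simp add: has_vector_derivative_def)
  qed
  then obtain c where c: "\<And>t. t \<in> I \<Longrightarrow> g t - w * cnj (g t) = c" by blast
  show ?thesis
  proof clarify
    fix t assume t: "t \<in> I"
    \<comment> \<open>The chord and \<open>g' t0\<close> are fixed by the same reflection, so their
      quotient is real.\<close>
    define z where "z = (g t - g t0) / g' t0"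
    have w0: "w \<noteq> 0" using g'_w[OF t0] nz[OF t0] by auto
    have chord: "g t - g t0 = w * cnj (g t - g t0)"
      using c[OF t] c[OF t0] by (simp add: right_diff_distrib) (metis add_diff_cancel_left add_diff_cancel_right diff_add_cancel)
    have "z = (w * cnj (g t - g t0)) / (w * cnj (g' t0))"
      unfolding z_def by (intro arg_cong2[where f = "(/)"] chord g'_w t0)
    also have "\<dots> = cnj z" using w0 by (simp add: z_def)
    finally have "z = of_real (Re z)" by (simp add: complex_eq_iff)
    then have "g t = g t0 + Re z *\<^sub>R g' t0"
      using nz[OF t0] by (metis add.commute diff_add_cancel nonzero_eq_divide_eq scaleR_conv_of_real z_def)
    then show "g t \<in> range (\<lambda>x. g t0 + x *\<^sub>R g' t0)" by blast
  qed
qed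

text \<open>\<open>Im (cnj z * w)\<close> is the determinant of \<open>z\<close> and
  \<open>w\<close> as vectors of the real plane, and this is Cramer's rule.\<close>

lemma complex_cramer:
  fixes r z w :: complex
  defines "d \<equiv> Im (cnj z * w)"
  assumes "d \<noteq> 0"
  shows "r = (Im (cnj r * w) / d) *\<^sub>R z + (Im (cnj z * r) / d) *\<^sub>R w"
proof -
  have "d *\<^sub>R r = Im (cnj r * w) *\<^sub>R z + Im (cnj z * r) *\<^sub>R w"
    by (simp add: d_def complex_eq_iff algebra_simps)
  then have "(1 / d) *\<^sub>R (d *\<^sub>R r) = (1 / d) *\<^sub>R (Im (cnj r * w) *\<^sub>R z + Im (cnj z * r) *\<^sub>R w)"
    by simp
  then show ?thesis using assms(2) by (simp add: scaleR_add_right)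
qed

lemma abs_Im_cnj_mult_le: "\<bar>Im (cnj z * w)\<bar> \<le> norm z * norm w"
  using abs_Im_le_cmod[of "cnj z * w"] by (simp add: norm_mult)

section \<open>Boundedness and blow-up\<close>

text \<open>A single copy \<open>J\<close> of \<open>I\<close> inside a compact subinterval
  suffices: the curve over \<open>J\<close> is bounded, and the whole curve is an affine image of
  it.\<close>

lemma self_affine_imp_bounded:
  assumes I: "interval I" and cont: "continuous_on I \<gamma>" and hsa: "harada_self_affine I \<gamma>"
  shows "bounded (\<gamma> ` I)"
proof -
  obtain t0 where "t0 \<in> interior I" using I by (auto simp: interval_def)
  from shrinking_subintervals[OF I this]
  obtain K \<epsilon>0 where \<epsilon>0: "0 < \<epsilon>0" "{t0 - \<epsilon>0..t0 + \<epsilon>0} \<subseteq> I"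
    and "(\<lambda>u. t0 + \<epsilon>0 * u) ` K \<subseteq> {t0 - \<epsilon>0..t0 + \<epsilon>0} \<and> interval ((\<lambda>u. t0 + \<epsilon>0 * u) ` K) \<and>
      (\<lambda>u. t0 + \<epsilon>0 * u) ` K homeomorphic I"
    by (metis order_refl)
  then obtain J where J: "J \<subseteq> {t0 - \<epsilon>0..t0 + \<epsilon>0}" "interval J" "J homeomorphic I" by blast
  then obtain B b where B: "linear B" "\<gamma> ` I = (\<lambda>t. B (\<gamma> t - b)) ` J"
    using self_affine_rescaling[OF hsa] \<epsilon>0 by (metis order_trans)
  have "compact (\<gamma> ` {t0 - \<epsilon>0..t0 + \<epsilon>0})"
    using \<epsilon>0 cont by (intro compact_continuous_image) (auto intro: continuous_on_subset)
  then have "bounded (\<gamma> ` J)"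
    using J(1) by (meson bounded_subset compact_imp_bounded image_mono)
  then have "bounded ((+) (- b) ` (\<gamma> ` J))"
    by (rule bounded_translation)
  then have "bounded (B ` (+) (- b) ` (\<gamma> ` J))"
    using B(1) by (rule bounded_linear_image[OF _ linear_conv_bounded_linear[THEN iffD1]])
  then show ?thesis using B(2) by (simp add: image_image)
qed

text \<open>Blow-up at a point of nonzero curvature: the subintervals of size \<open>\<epsilon>\<close> around \<open>t\<^sub>0\<close> approach, after
  the anisotropic affine rescaling along \<open>\<gamma>'\<close> and \<open>\<gamma>''\<close>, arcs of the standard parabola, while
  self-affinity identifies each of them with the whole curve.\<close>

lemma self_affine_blow_up:
  assumes I: "interval I" and hsa: "harada_self_affine I \<gamma>" and bdd: "bounded (\<gamma> ` I)"
    and \<gamma>: "\<And>t. t \<in> I \<Longrightarrow> (\<gamma> has_vector_derivative g' t) (at t within I)"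
    and t0: "t0 \<in> interior I"
    and g': "(g' has_vector_derivative g'') (at t0 within I)"
    and det: "Im (cnj (g' t0) * g'') \<noteq> 0"
  obtains a b e where "\<gamma> ` I \<subseteq> range (\<lambda>x::real. e + x *\<^sub>R a + x\<^sup>2 *\<^sub>R b)"
proof -
  define d where "d = Im (cnj (g' t0) * g'')"
  have d: "d \<noteq> 0" using det by (simp add: d_def)
  \<comment> \<open>\<open>C\<close> bounds both Cramer coefficients of a vector in the frame g',
    g'' by a multiple of its norm.\<close>
  define C where "C = (norm (g' t0) + norm g'') / \<bar>d\<bar>"
  have "g' t0 \<noteq> 0" using det by auto
  then have C: "C > 0" using d by (auto simp: C_def intro!: divide_pos_pos add_pos_nonneg)
  obtain K h \<epsilon>0 where K: "K \<subseteq> {-1..1}" and h: "0 < h" "{-h, 0, h} \<subseteq> K"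
    and \<epsilon>0: "0 < \<epsilon>0" "{t0 - \<epsilon>0..t0 + \<epsilon>0} \<subseteq> I"
    and J: "\<And>\<epsilon>. 0 < \<epsilon> \<Longrightarrow> \<epsilon> \<le> \<epsilon>0 \<Longrightarrow> (\<lambda>u. t0 + \<epsilon> * u) ` K \<subseteq> {t0 - \<epsilon>..t0 + \<epsilon>} \<and>
      interval ((\<lambda>u. t0 + \<epsilon> * u) ` K) \<and> (\<lambda>u. t0 + \<epsilon> * u) ` K homeomorphic I"
    using shrinking_subintervals[OF I t0] by blast
  have approx: "\<exists>a b e \<xi> \<eta>. (\<forall>u\<in>K. \<bar>\<xi> u - u\<bar> \<le> \<delta> \<and> \<bar>\<eta> u - u\<^sup>2\<bar> \<le> \<delta>) \<and>
      \<gamma> ` I = (\<lambda>u. e + \<xi> u *\<^sub>R a + \<eta> u *\<^sub>R b) ` K" if \<delta>: "\<delta> > 0" for \<delta>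
  proof -
    \<comment> \<open>The 2 compensates the factor in
      \<open>2 * \<beta> u / \<epsilon>\<^sup>2\<close>, which comes from the 1/2 in the Taylor
      term.\<close>
    define \<delta>' where "\<delta>' = \<delta> / (2 * C)"
    have \<delta>': "\<delta>' > 0" using \<delta> C by (simp add: \<delta>'_def)
    have t0I: "t0 \<in> I" and intI: "is_interval I"
      using I t0 interior_subset by (auto simp: interval_def)
    obtain \<rho> where \<rho>: "\<rho> > 0" and taylor: "\<And>t. t \<in> I \<Longrightarrow> \<bar>t - t0\<bar> < \<rho> \<Longrightarrow>
      norm (\<gamma> t - \<gamma> t0 - (t - t0) *\<^sub>R g' t0 - ((t - t0)\<^sup>2 / 2) *\<^sub>R g'') \<le> \<delta>' * (t - t0)\<^sup>2"
      using taylor_second_order[OF intI t0I \<delta>' \<gamma> g'] by blast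
    \<comment> \<open>The three bounds give \<epsilon>^2 \<le> \<epsilon>, keep the arc over a part
      of \<open>I\<close>, and keep it where the Taylor estimate is valid.\<close>
    define \<epsilon> where "\<epsilon> = min (min 1 \<epsilon>0) (\<rho> / 2)"
    have \<epsilon>: "0 < \<epsilon>" "\<epsilon> \<le> 1" "\<epsilon> \<le> \<epsilon>0" "\<epsilon> < \<rho>" using \<rho> \<epsilon>0 by (auto simp: \<epsilon>_def)
    note J\<epsilon> = J[OF \<epsilon>(1,3)]
    have J_sub: "(\<lambda>u. t0 + \<epsilon> * u) ` K \<subseteq> I"
    proof -
      have "(\<lambda>u. t0 + \<epsilon> * u) ` K \<subseteq> {t0 - \<epsilon>..t0 + \<epsilon>}" using J\<epsilon> by blast
      also have "\<dots> \<subseteq> {t0 - \<epsilon>0..t0 + \<epsilon>0}" using \<epsilon> by auto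
      finally show ?thesis using \<epsilon>0 by blast
    qed
    obtain B p where B: "linear B" and resc: "\<gamma> ` I = (\<lambda>t. B (\<gamma> t - p)) ` (\<lambda>u. t0 + \<epsilon> * u) ` K"
      using self_affine_rescaling[OF hsa J_sub] J\<epsilon> by blast
    define R where "R u = \<gamma> (t0 + \<epsilon> * u) - \<gamma> t0 - (\<epsilon> * u) *\<^sub>R g' t0 - ((\<epsilon> * u)\<^sup>2 / 2) *\<^sub>R g''" for u
    define \<alpha> where "\<alpha> u = Im (cnj (R u) * g'') / d" for u
    define \<beta> where "\<beta> u = Im (cnj (g' t0) * R u) / d" for u
    \<comment> \<open>These are the coordinates of the arc in the rescaled frame \<epsilon> g',
      (\<epsilon>^2 / 2) g''. Since the remainder is o(\<epsilon>^2), its components divided by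
      \<epsilon> and \<epsilon>^2 are small uniformly in \<open>u\<close>.\<close>
    define \<xi> where "\<xi> u = u + \<alpha> u / \<epsilon>" for u
    define \<eta> where "\<eta> u = u\<^sup>2 + 2 * \<beta> u / \<epsilon>\<^sup>2" for u
    have R: "R u = \<alpha> u *\<^sub>R g' t0 + \<beta> u *\<^sub>R g''" for u
      unfolding \<alpha>_def \<beta>_def d_def by (rule complex_cramer) (fact det)
    have \<gamma>_eq: "\<gamma> (t0 + \<epsilon> * u) = \<gamma> t0 + \<xi> u *\<^sub>R (\<epsilon> *\<^sub>R g' t0) + \<eta> u *\<^sub>R ((\<epsilon>\<^sup>2 / 2) *\<^sub>R g'')" for u
    proof -
      have "\<xi> u * \<epsilon> = \<epsilon> * u + \<alpha> u" "\<eta> u * (\<epsilon>\<^sup>2 / 2) = (\<epsilon> * u)\<^sup>2 / 2 + \<beta> u"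
        using \<epsilon> by (simp_all add: \<xi>_def \<eta>_def field_simps power2_eq_square)
      then have "\<gamma> t0 + \<xi> u *\<^sub>R (\<epsilon> *\<^sub>R g' t0) + \<eta> u *\<^sub>R ((\<epsilon>\<^sup>2 / 2) *\<^sub>R g'')
          = \<gamma> t0 + (\<epsilon> * u + \<alpha> u) *\<^sub>R g' t0 + ((\<epsilon> * u)\<^sup>2 / 2 + \<beta> u) *\<^sub>R g''"
        by (simp only: scaleR_scaleR)
      also have "\<dots> = \<gamma> t0 + (\<epsilon> * u) *\<^sub>R g' t0 + ((\<epsilon> * u)\<^sup>2 / 2) *\<^sub>R g'' + R u"
        unfolding R by (simp add: scaleR_add_left)
      also have "\<dots> = \<gamma> (t0 + \<epsilon> * u)" by (simp add: R_def)
      finally show ?thesis by simp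
    qed
    have "\<bar>\<xi> u - u\<bar> \<le> \<delta> \<and> \<bar>\<eta> u - u\<^sup>2\<bar> \<le> \<delta>" if u: "u \<in> K" for u
    proof -
      have u1: "\<bar>u\<bar> \<le> 1" using subsetD[OF K u] by auto
      have "\<bar>\<epsilon> * u\<bar> \<le> \<epsilon>" using u1 \<epsilon> by (simp add: abs_mult mult_left_le)
      then have "norm (R u) \<le> \<delta>' * (\<epsilon> * u)\<^sup>2"
        using taylor[of "t0 + \<epsilon> * u"] J_sub u \<epsilon> by (force simp: R_def)
      also have "\<dots> \<le> \<delta>' * \<epsilon>\<^sup>2"
        using \<open>\<bar>\<epsilon> * u\<bar> \<le> \<epsilon>\<close> \<delta>' \<epsilon> by (intro mult_left_mono) (simp_all add: abs_le_square_iff[symmetric])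
      finally have R_le: "norm (R u) \<le> \<delta>' * \<epsilon>\<^sup>2" .
      have C': "norm (g' t0) / \<bar>d\<bar> \<le> C" "norm g'' / \<bar>d\<bar> \<le> C"
        by (auto simp: C_def divide_right_mono)
      have "\<bar>\<alpha> u\<bar> \<le> norm (R u) * (norm g'' / \<bar>d\<bar>)"
        using abs_Im_cnj_mult_le[of "R u" g''] by (simp add: \<alpha>_def abs_divide divide_right_mono)
      also have "\<dots> \<le> (\<delta>' * \<epsilon>\<^sup>2) * C"
        using R_le C' \<delta>' C by (intro mult_mono) auto
      finally have \<alpha>: "\<bar>\<alpha> u\<bar> \<le> \<delta> / 2 * \<epsilon>\<^sup>2" using C by (simp add: \<delta>'_def)
      have "\<bar>\<beta> u\<bar> \<le> (norm (g' t0) / \<bar>d\<bar>) * norm (R u)"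
        using abs_Im_cnj_mult_le[of "g' t0" "R u"] by (simp add: \<beta>_def abs_divide divide_right_mono)
      also have "\<dots> \<le> C * (\<delta>' * \<epsilon>\<^sup>2)"
        using R_le C' \<delta>' C by (intro mult_mono) auto
      finally have \<beta>: "\<bar>\<beta> u\<bar> \<le> \<delta> / 2 * \<epsilon>\<^sup>2" using C by (simp add: \<delta>'_def)
      have "\<epsilon>\<^sup>2 \<le> \<epsilon>" using \<epsilon> by (simp add: power2_eq_square mult_left_le)
      then have "\<delta> / 2 * \<epsilon>\<^sup>2 \<le> \<delta> * \<epsilon>" using \<delta> \<epsilon> by (intro mult_mono) auto
      then have "\<bar>\<alpha> u\<bar> \<le> \<delta> * \<epsilon>" using \<alpha> by linarith
      then have "\<bar>\<xi> u - u\<bar> \<le> \<delta>" using \<epsilon> by (simp add: \<xi>_def abs_divide divide_le_eq)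
      moreover have "\<bar>\<eta> u - u\<^sup>2\<bar> \<le> \<delta>"
        using \<beta> \<epsilon> by (simp add: \<eta>_def abs_divide abs_mult divide_le_eq)
      ultimately show ?thesis by blast
    qed
    moreover have "B (\<gamma> (t0 + \<epsilon> * u) - p) = B (\<gamma> t0 - p) + \<xi> u *\<^sub>R B (\<epsilon> *\<^sub>R g' t0) + \<eta> u *\<^sub>R B ((\<epsilon>\<^sup>2 / 2) *\<^sub>R g'')" for u
    proof -
      have "\<gamma> (t0 + \<epsilon> * u) - p = (\<gamma> t0 - p) + \<xi> u *\<^sub>R (\<epsilon> *\<^sub>R g' t0) + \<eta> u *\<^sub>R ((\<epsilon>\<^sup>2 / 2) *\<^sub>R g'')"
        using \<gamma>_eq[of u] by simp
      then show ?thesis using B by (simp only: linear_add linear_scale)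
    qed
    then have "\<gamma> ` I = (\<lambda>u. B (\<gamma> t0 - p) + \<xi> u *\<^sub>R B (\<epsilon> *\<^sub>R g' t0) + \<eta> u *\<^sub>R B ((\<epsilon>\<^sup>2 / 2) *\<^sub>R g'')) ` K"
      by (simp add: resc image_image)
    ultimately show ?thesis by blast
  qed
  show thesis
    by (rule quadratic_limit[OF bdd h K approx]) (assumption | rule that)+
qed

lemma self_affine_imp_line_or_parabola:
  assumes "curve I \<gamma>" and hsa: "harada_self_affine I \<gamma>"
  shows "bounded (\<gamma> ` I)"
    and "(\<exists>L. is_line L \<and> \<gamma> ` I \<subseteq> L) \<or> (\<exists>P. is_parabola P \<and> \<gamma> ` I \<subseteq> P)"
proof -
  have I: "interval I" using assms by (simp add: curve_def)
  obtain D where D0: "\<And>t. t \<in> I \<Longrightarrow> D 0 t = \<gamma> t"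
    and D: "\<And>n t. t \<in> I \<Longrightarrow> (D n has_vector_derivative D (Suc n) t) (at t within I)"
    and D1: "\<And>t. t \<in> I \<Longrightarrow> D 1 t \<noteq> 0"
    using curve_derivatives[OF assms(1)] by blast
  have \<gamma>: "(\<gamma> has_vector_derivative D 1 t) (at t within I)" if "t \<in> I" for t
    using has_vector_derivative_transform[OF that _ D[OF that, of 0], of \<gamma>] D0 by simp
  have D_cont: "continuous_on I (D n)" for n
    using D by (intro continuous_on_vector_derivative)
  have "continuous_on I \<gamma>" using \<gamma> by (rule continuous_on_vector_derivative)
  then show bdd: "bounded (\<gamma> ` I)" by (rule self_affine_imp_bounded[OF I _ hsa])
  define \<kappa> where "\<kappa> t = Im (cnj (D 1 t) * D 2 t)" for t
  have D2: "(D 1 has_vector_derivative D 2 t) (at t within I)" if "t \<in> I" for t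
    using D[OF that, of 1] by (simp add: numeral_2_eq_2)
  obtain a b e where "\<gamma> ` I \<subseteq> range (\<lambda>x::real. e + x *\<^sub>R a + x\<^sup>2 *\<^sub>R b)"
  proof (cases "\<forall>t\<in>I. \<kappa> t = 0")
    case True
    have "is_interval I" using I by (simp add: interval_def)
    moreover obtain t0 where "t0 \<in> I" using I by (auto simp: interval_iff)
    ultimately have "\<gamma> ` I \<subseteq> range (\<lambda>x. \<gamma> t0 + x *\<^sub>R D 1 t0)"
      using zero_curvature_imp_segment[of I t0 \<gamma> "D 1" "D 2"] \<gamma> D2 D1 True by (simp add: \<kappa>_def)
    then show thesis using that[of "\<gamma> t0" "D 1 t0" 0] by simp
  next
    case False
    then obtain t1 where t1: "t1 \<in> I" "\<kappa> t1 \<noteq> 0" by blast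
    have "continuous_on I \<kappa>"
      unfolding \<kappa>_def by (intro continuous_intros D_cont)
    then have "openin (top_of_set I) (I \<inter> \<kappa> -` (- {0}))"
      by (rule continuous_openin_preimage_gen) auto
    then obtain U where U: "open U" "I \<inter> \<kappa> -` (- {0}) = I \<inter> U"
      by (auto simp: openin_open)
    \<comment> \<open>The point \<open>t1\<close> may be an endpoint, while the blow-up needs room
      on both sides. Continuity of the curvature determinant allows a move into the
      interior.\<close>
    have "t1 \<in> closure (interior I)"
      using I t1 convex_closure_interior[of I] closure_subset
      by (auto simp: interval_def is_interval_convex)
    moreover have "t1 \<in> U" using U t1 by auto
    ultimately obtain t0 where t0: "t0 \<in> interior I" "t0 \<in> U"
      using U(1) by (meson closure_iff_nhds_not_empty disjoint_iff subset_refl)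
    then have "t0 \<in> I" using interior_subset by blast
    then have det: "Im (cnj (D 1 t0) * D 2 t0) \<noteq> 0" using U t0 unfolding \<kappa>_def by blast
    show thesis
      by (rule self_affine_blow_up[OF I hsa bdd \<gamma> t0(1) D2[OF \<open>t0 \<in> I\<close>] det]) (assumption | rule that)+
  qed
  then show "(\<exists>L. is_line L \<and> \<gamma> ` I \<subseteq> L) \<or> (\<exists>P. is_parabola P \<and> \<gamma> ` I \<subseteq> P)"
    by (rule quadratic_arc_line_or_parabola)
qed

subsection \<open>Arcs of lines and parabolas are self-affine\<close>

lemma continuous_inj_on_interval_monotone:
  fixes g :: "real \<Rightarrow> real"
  assumes X: "is_interval X" and cont: "continuous_on X g" and inj: "inj_on g X"
  shows "strict_mono_on X g \<or> strict_mono_on X (\<lambda>x. - g x)"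
proof -
  \<comment> \<open>The difference \<open>g y - g x\<close> has no zero on the convex set \<open>x < y\<close>, hence constant sign.\<close>
  define T where "T = {p \<in> X \<times> X. fst p < snd p}"
  \<comment> \<open>Written as a product cut by an open half-plane, \<open>T\<close> is visibly
    convex.\<close>
  have T_eq: "T = X \<times> X \<inter> {p. 0 < (-1, 1) \<bullet> p}"
    by (auto simp: T_def inner_prod_def)
  have "convex T"
    unfolding T_eq using X
    by (intro convex_Int convex_Times is_interval_convex convex_halfspace_gt)
  have "T \<subseteq> X \<times> X" by (auto simp: T_def)
  then have "continuous_on T (\<lambda>p. g (snd p) - g (fst p))"
    by (intro continuous_intros continuous_on_compose2[OF cont]) auto
  then have "connected ((\<lambda>p. g (snd p) - g (fst p)) ` T)"
    using \<open>convex T\<close> by (intro connected_continuous_image convex_connected)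
  then have ivl: "is_interval ((\<lambda>p. g (snd p) - g (fst p)) ` T)" (is "is_interval ?V")
    by (simp add: is_interval_connected_1)
  have nz: "0 \<notin> ?V" using inj by (auto simp: T_def inj_on_def)
  have "\<not> ((\<exists>a\<in>?V. a < 0) \<and> (\<exists>b\<in>?V. 0 < b))"
    using nz mem_is_interval_1_I[OF ivl] by (meson less_imp_le)
  moreover have "strict_mono_on X g" if "\<not> (\<exists>a\<in>?V. a < 0)"
  proof (rule strict_mono_onI)
    fix r s assume "r \<in> X" "s \<in> X" "r < s"
    then have "g s - g r \<in> ?V" by (intro image_eqI[of _ _ "(r, s)"]) (auto simp: T_def)
    then show "g r < g s" using that nz by (metis diff_gt_0_iff_gt linorder_neqE)
  qed
  moreover have "strict_mono_on X (\<lambda>x. - g x)" if "\<not> (\<exists>b\<in>?V. 0 < b)"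
  proof (rule strict_mono_onI)
    fix r s assume "r \<in> X" "s \<in> X" "r < s"
    then have "g s - g r \<in> ?V" by (intro image_eqI[of _ _ "(r, s)"]) (auto simp: T_def)
    then show "- g r < - g s" using that nz by (metis diff_less_0_iff_less linorder_neqE neg_less_iff_less)
  qed
  ultimately show ?thesis by blast
qed

lemma mem_bounded_interval_iff:
  fixes X :: "real set"
  assumes X: "is_interval X" "bounded X" "X \<noteq> {}"
  shows "y \<in> X \<longleftrightarrow> Inf X < y \<and> y < Sup X \<or> y = Inf X \<and> Inf X \<in> X \<or> y = Sup X \<and> Sup X \<in> X"
proof
  assume y: "y \<in> X"
  have "Inf X \<le> y" "y \<le> Sup X"
    using y X by (auto intro!: cInf_lower cSup_upper simp: bounded_imp_bdd_below bounded_imp_bdd_above)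
  then show "Inf X < y \<and> y < Sup X \<or> y = Inf X \<and> Inf X \<in> X \<or> y = Sup X \<and> Sup X \<in> X"
    using y by (metis order_le_less)
next
  assume "Inf X < y \<and> y < Sup X \<or> y = Inf X \<and> Inf X \<in> X \<or> y = Sup X \<and> Sup X \<in> X"
  moreover have "y \<in> X" if "Inf X < y" "y < Sup X"
  proof -
    obtain a where "a \<in> X" "a < y" using cInf_lessD[OF X(3) \<open>Inf X < y\<close>] by blast
    moreover obtain b where "b \<in> X" "y < b" using less_cSupD[OF X(3) \<open>y < Sup X\<close>] by blast
    ultimately show ?thesis using mem_is_interval_1_I[OF X(1)] by (meson less_imp_le)
  qed
  ultimately show "y \<in> X" by auto
qed

text \<open>The right-hand side speaks of the order alone, so attainment of an endpoint transfers
  along strictly increasing bijections.\<close>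

lemma Inf_mem_iff:
  fixes X :: "real set"
  assumes "bounded X"
  shows "Inf X \<in> X \<longleftrightarrow> (\<exists>m\<in>X. \<forall>x\<in>X. m \<le> x)"
  using assms by (metis bounded_imp_bdd_below cInf_eq_minimum cInf_lower)

lemma Sup_mem_iff:
  fixes X :: "real set"
  assumes "bounded X"
  shows "Sup X \<in> X \<longleftrightarrow> (\<exists>m\<in>X. \<forall>x\<in>X. x \<le> m)"
  using assms by (metis bounded_imp_bdd_above cSup_eq_maximum cSup_upper)

text \<open>A bounded interval is determined by its infimum, its supremum and which of them it
  contains. The map \<open>g\<close> serves only to match the latter; the increasing affine map
  matching the endpoints does the rest.\<close>

lemma affine_map_onto_order_isomorphic_interval:
  fixes g :: "real \<Rightarrow> real"
  assumes X: "interval X" "bounded X" and Y: "interval Y" "bounded Y"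
    and g: "strict_mono_on X g" "g ` X = Y"
  obtains \<alpha> \<beta> where "\<alpha> \<noteq> 0" "(\<lambda>x. \<alpha> * x + \<beta>) ` X = Y"
proof -
  have width: "Inf Z < Sup Z" if Z: "interval Z" "bounded Z" for Z :: "real set"
  proof -
    obtain a b where "a \<in> Z" "b \<in> Z" "a < b" using Z by (auto simp: interval_iff)
    then have "Inf Z \<le> a" "b \<le> Sup Z"
      using Z by (auto intro!: cInf_lower cSup_upper simp: bounded_imp_bdd_below bounded_imp_bdd_above)
    then show ?thesis using \<open>a < b\<close> by linarith
  qed
  have mem: "y \<in> Z \<longleftrightarrow> Inf Z < y \<and> y < Sup Z \<or> y = Inf Z \<and> Inf Z \<in> Z \<or> y = Sup Z \<and> Sup Z \<in> Z"
    if "interval Z" "bounded Z" for Z :: "real set" and y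
    using that by (intro mem_bounded_interval_iff) (auto simp: interval_iff)
  have g_le: "g a \<le> g b \<longleftrightarrow> a \<le> b" if "a \<in> X" "b \<in> X" for a b
    using that g(1) by (metis linorder_not_less order_le_less strict_mono_onD)
  have InfY: "Inf Y \<in> Y \<longleftrightarrow> Inf X \<in> X" and SupY: "Sup Y \<in> Y \<longleftrightarrow> Sup X \<in> X"
    unfolding Inf_mem_iff[OF X(2)] Inf_mem_iff[OF Y(2)] Sup_mem_iff[OF X(2)] Sup_mem_iff[OF Y(2)]
    unfolding g(2)[symmetric]
    by (simp_all add: g_le cong: bex_cong ball_cong)
  define \<alpha> where "\<alpha> = (Sup Y - Inf Y) / (Sup X - Inf X)"
  define \<beta> where "\<beta> = Inf Y - \<alpha> * Inf X"
  have \<alpha>: "\<alpha> > 0" using width[OF X] width[OF Y] by (simp add: \<alpha>_def)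
  have "\<alpha> * (Sup X - Inf X) = Sup Y - Inf Y" using width[OF X] by (simp add: \<alpha>_def)
  then have ends: "Inf Y = \<alpha> * Inf X + \<beta>" "Sup Y = \<alpha> * Sup X + \<beta>"
    by (auto simp: \<beta>_def algebra_simps)
  have iff: "\<alpha> * x + \<beta> \<in> Y \<longleftrightarrow> x \<in> X" for x
    unfolding mem[OF Y, of "\<alpha> * x + \<beta>"] mem[OF X, of x] InfY SupY
    using \<alpha> by (simp add: ends)
  have "(\<lambda>x. \<alpha> * x + \<beta>) ` X = Y"
  proof (intro equalityI subsetI)
    fix y assume "y \<in> Y"
    moreover have "y = \<alpha> * ((y - \<beta>) / \<alpha>) + \<beta>" using \<alpha> by simp
    ultimately show "y \<in> (\<lambda>x. \<alpha> * x + \<beta>) ` X" using iff by (metis imageI)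
  qed (use iff in auto)
  then show thesis using that[of \<alpha> \<beta>] \<alpha> by simp
qed

lemma affine_map_onto_homeomorphic_interval:
  fixes X Y :: "real set"
  assumes X: "interval X" "bounded X" and Y: "interval Y" "bounded Y" and "X homeomorphic Y"
  obtains \<alpha> \<beta> where "\<alpha> \<noteq> 0" "(\<lambda>x. \<alpha> * x + \<beta>) ` X = Y"
proof -
  obtain g g' where hom: "homeomorphism X Y g g'" using assms by (auto simp: homeomorphic_def)
  then have g: "continuous_on X g" "g ` X = Y" "inj_on g X"
    by (auto simp: homeomorphism_def intro: inj_on_inverseI[of _ g'])
  then consider "strict_mono_on X g" | "strict_mono_on X (\<lambda>x. - g x)"
    using continuous_inj_on_interval_monotone X(1) by (auto simp: interval_def)
  then show thesis
  proof cases
    case 1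
    then show thesis using affine_map_onto_order_isomorphic_interval[OF X Y _ g(2)] that by blast
  next
    case 2
    \<comment> \<open>An orientation-reversing homeomorphism becomes increasing after reflecting
      \<open>Y\<close>; undoing the reflection makes the slope negative.\<close>
    have inj: "inj_on uminus Y" and cont: "continuous_on Y uminus"
      by (auto intro: continuous_intros)
    have "interval (uminus ` Y)" "bounded (uminus ` Y)"
      using interval_injective_image[OF Y(1) cont inj] Y(2) by (simp_all add: bounded_uminus)
    moreover have "(\<lambda>x. - g x) ` X = uminus ` Y" using g(2) by auto
    ultimately obtain \<alpha> \<beta> where \<alpha>: "\<alpha> \<noteq> 0" "(\<lambda>x. \<alpha> * x + \<beta>) ` X = uminus ` Y"
      using affine_map_onto_order_isomorphic_interval[OF X _ _ 2] by blast
    have "(\<lambda>x. - \<alpha> * x + - \<beta>) ` X = uminus ` (\<lambda>x. \<alpha> * x + \<beta>) ` X"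
      by (auto simp: image_image)
    also have "\<dots> = Y" unfolding \<alpha>(2) by (simp add: image_image)
    finally show thesis using that[of "- \<alpha>" "- \<beta>"] \<alpha>(1) by simp
  qed
qed

section \<open>Smoothness of the reparametrization\<close>

text \<open>Choosing a derivative inside \<open>C\<close> for each member and iterating the choice
  produces all derivatives, so no formula for the n-th one is required.\<close>

lemma smooth_on_interval_coinduct:
  assumes f: "f \<in> C"
    and C: "\<And>f. f \<in> C \<Longrightarrow> \<exists>g\<in>C. \<forall>t\<in>I. (f has_vector_derivative g t) (at t within I)"
  shows "smooth_on_interval I f"
proof -
  obtain d where d: "\<And>f. f \<in> C \<Longrightarrow> d f \<in> C"
    "\<And>f t. f \<in> C \<Longrightarrow> t \<in> I \<Longrightarrow> (f has_vector_derivative d f t) (at t within I)"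
    using C by metis
  have "(d ^^ n) f \<in> C" for n by (induction n) (auto simp: f d)
  then show ?thesis
    unfolding smooth_on_interval_def by (intro exI[of _ "\<lambda>n. (d ^^ n) f"]) (auto simp: d)
qed

text \<open>The functions occurring as derivatives of a solution \<open>\<sigma>\<close> of \<open>x (\<sigma> t) = \<alpha> x(t) + \<beta>\<close>, where
  \<open>X n\<close> stands for the \<open>n\<close>-th derivative of \<open>x\<close>.\<close>

inductive_set jet_ring :: "(nat \<Rightarrow> real \<Rightarrow> real) \<Rightarrow> (real \<Rightarrow> real) \<Rightarrow> (real \<Rightarrow> real) set"
  for X \<sigma> where
  const: "(\<lambda>t. c) \<in> jet_ring X \<sigma>"
| jet: "X n \<in> jet_ring X \<sigma>"
| jet_comp: "(\<lambda>t. X n (\<sigma> t)) \<in> jet_ring X \<sigma>"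
| inverse: "(\<lambda>t. inverse (X 1 (\<sigma> t))) \<in> jet_ring X \<sigma>"
| add: "f \<in> jet_ring X \<sigma> \<Longrightarrow> g \<in> jet_ring X \<sigma> \<Longrightarrow> (\<lambda>t. f t + g t) \<in> jet_ring X \<sigma>"
| mult: "f \<in> jet_ring X \<sigma> \<Longrightarrow> g \<in> jet_ring X \<sigma> \<Longrightarrow> (\<lambda>t. f t * g t) \<in> jet_ring X \<sigma>"

text \<open>The difference quotient of \<open>\<sigma>\<close> is that of \<alpha> x at
  \<open>t\<close> divided by that of \<open>x\<close> at \<open>\<sigma> t\<close>. Limits within
  \<open>I\<close> cover endpoints as well.\<close>

lemma has_field_derivative_conjugate:
  fixes x \<sigma> :: "real \<Rightarrow> real"
  assumes x: "\<And>t. t \<in> I \<Longrightarrow> (x has_field_derivative x' t) (at t within I)"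
    and nz: "\<And>t. t \<in> I \<Longrightarrow> x' t \<noteq> 0"
    and \<sigma>: "\<sigma> ` I \<subseteq> I" "continuous_on I \<sigma>" "inj_on \<sigma> I" and x_inj: "inj_on x I"
    and conj: "\<And>t. t \<in> I \<Longrightarrow> x (\<sigma> t) = \<alpha> * x t + \<beta>" and t: "t \<in> I"
  shows "(\<sigma> has_field_derivative \<alpha> * x' t * inverse (x' (\<sigma> t))) (at t within I)"
proof -
  have \<sigma>t: "\<sigma> t \<in> I" using \<sigma> t by auto
  have ev: "\<forall>\<^sub>F s in at t within I. s \<in> I \<and> s \<noteq> t"
    by (auto simp: eventually_at_filter)
  \<comment> \<open>Injectivity keeps \<open>\<sigma> s\<close> away from \<open>\<sigma> t\<close>,
    so the punctured limit at \<open>\<sigma> t\<close> may be composed with \<open>\<sigma>\<close>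
    and the quotients can be cancelled.\<close>
  have ne: "\<sigma> s \<noteq> \<sigma> t" "x (\<sigma> s) \<noteq> x (\<sigma> t)" if "s \<in> I" "s \<noteq> t" for s
    using that t \<sigma>(1) inj_onD[OF \<sigma>(3), of s t] inj_onD[OF x_inj, of "\<sigma> s" "\<sigma> t"] by blast+
  have "(\<sigma> \<longlongrightarrow> \<sigma> t) (at t within I)" using \<sigma>(2) t by (simp add: continuous_on)
  then have lim: "filterlim \<sigma> (at (\<sigma> t) within I) (at t within I)"
    using eventually_mono[OF ev] ne \<sigma>(1) unfolding filterlim_at by (smt (verit) image_subset_iff)
  have "((\<lambda>y. (x y - x (\<sigma> t)) / (y - \<sigma> t)) \<longlongrightarrow> x' (\<sigma> t)) (at (\<sigma> t) within I)"
    using x[OF \<sigma>t] by (simp add: has_field_derivative_iff)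
  then have L1: "((\<lambda>s. (x (\<sigma> s) - x (\<sigma> t)) / (\<sigma> s - \<sigma> t)) \<longlongrightarrow> x' (\<sigma> t)) (at t within I)"
    by (rule filterlim_compose[OF _ lim])
  have L2: "((\<lambda>s. \<alpha> * ((x s - x t) / (s - t))) \<longlongrightarrow> \<alpha> * x' t) (at t within I)"
    using x[OF t] by (intro tendsto_mult_left) (simp add: has_field_derivative_iff)
  have "((\<lambda>s. \<alpha> * ((x s - x t) / (s - t)) * inverse ((x (\<sigma> s) - x (\<sigma> t)) / (\<sigma> s - \<sigma> t)))
      \<longlongrightarrow> \<alpha> * x' t * inverse (x' (\<sigma> t))) (at t within I)"
    by (intro tendsto_mult tendsto_inverse L1 L2 nz \<sigma>t)
  moreover have "\<forall>\<^sub>F s in at t within I. \<alpha> * ((x s - x t) / (s - t)) *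
      inverse ((x (\<sigma> s) - x (\<sigma> t)) / (\<sigma> s - \<sigma> t)) = (\<sigma> s - \<sigma> t) / (s - t)"
  proof (rule eventually_mono[OF ev])
    fix s assume s: "s \<in> I \<and> s \<noteq> t"
    have "\<alpha> * (x s - x t) = x (\<sigma> s) - x (\<sigma> t)"
      using conj s t by (simp add: algebra_simps)
    then have "\<alpha> * ((x s - x t) / (s - t)) = (x (\<sigma> s) - x (\<sigma> t)) / (s - t)" by simp
    then show "\<alpha> * ((x s - x t) / (s - t)) * inverse ((x (\<sigma> s) - x (\<sigma> t)) / (\<sigma> s - \<sigma> t)) = (\<sigma> s - \<sigma> t) / (s - t)"
      using ne[of s] s by (simp add: divide_simps)
  qed
  ultimately show ?thesis
    unfolding has_field_derivative_iff by (rule Lim_transform_eventually)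
qed

text \<open>The derivative \<open>s\<close> of \<open>\<sigma>\<close> lies in
  \<open>jet_ring X \<sigma>\<close>. By the chain rule each generator has its derivative in the
  ring, and sums and products inherit this.\<close>

lemma smooth_conjugate:
  fixes X :: "nat \<Rightarrow> real \<Rightarrow> real"
  assumes X: "\<And>n t. t \<in> I \<Longrightarrow> (X n has_vector_derivative X (Suc n) t) (at t within I)"
    and nz: "\<And>t. t \<in> I \<Longrightarrow> X 1 t \<noteq> 0"
    and \<sigma>: "\<sigma> ` I \<subseteq> I" "continuous_on I \<sigma>" "inj_on \<sigma> I" and inj: "inj_on (X 0) I"
    and conj: "\<And>t. t \<in> I \<Longrightarrow> X 0 (\<sigma> t) = \<alpha> * X 0 t + \<beta>"
  shows "smooth_on_interval I \<sigma>"
proof -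
  have X': "(X n has_field_derivative X (Suc n) t) (at t within I)" if "t \<in> I" for n t
    using X[OF that] by (simp add: has_real_derivative_iff_has_vector_derivative)
  define s where "s t = \<alpha> * X 1 t * inverse (X 1 (\<sigma> t))" for t
  have s: "s \<in> jet_ring X \<sigma>"
    unfolding s_def by (intro jet_ring.intros)
  have \<sigma>': "(\<sigma> has_field_derivative s t) (at t within I)" if "t \<in> I" for t
    unfolding s_def
    using has_field_derivative_conjugate[of I "X 0" "X 1" \<sigma> \<alpha> \<beta> t] X'[of _ 0] nz \<sigma> inj conj that by simp
  have comp: "((\<lambda>t. X n (\<sigma> t)) has_field_derivative X (Suc n) (\<sigma> t) * s t) (at t within I)" if "t \<in> I" for n t
  proof -
    have "\<sigma> t \<in> I" using that \<sigma> by auto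
    then have "(X n has_field_derivative X (Suc n) (\<sigma> t)) (at (\<sigma> t) within \<sigma> ` I)"
      using X' has_field_derivative_subset \<sigma>(1) by blast
    then show ?thesis using DERIV_image_chain[OF _ \<sigma>'[OF that]] by (simp add: o_def)
  qed
  have ring: "\<exists>g\<in>jet_ring X \<sigma>. \<forall>t\<in>I. (f has_field_derivative g t) (at t within I)" if "f \<in> jet_ring X \<sigma>" for f
    using that
  proof induction
    case (const c)
    then show ?case by (intro bexI[of _ "\<lambda>t. 0"]) (auto intro: jet_ring.intros)
  next
    case (jet n)
    then show ?case using X' by (intro bexI[of _ "X (Suc n)"]) (auto intro: jet_ring.intros)
  next
    case (jet_comp n)
    then show ?case
      using comp by (intro bexI[of _ "\<lambda>t. X (Suc n) (\<sigma> t) * s t"]) (auto intro: jet_ring.intros s)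
  next
    case inverse
    let ?r = "\<lambda>t. inverse (X 1 (\<sigma> t))"
    \<comment> \<open>The sign is a constant factor because the ring has constants and products but
      no rule for negation.\<close>
    let ?g = "\<lambda>t. (- 1) * (?r t * (X (Suc 1) (\<sigma> t) * s t) * ?r t)"
    have "?g \<in> jet_ring X \<sigma>" by (intro jet_ring.intros s)
    moreover have "(?r has_field_derivative ?g t) (at t within I)" if t: "t \<in> I" for t
    proof -
      have "X 1 (\<sigma> t) \<noteq> 0" using nz \<sigma> t by auto
      from DERIV_inverse'[OF comp[OF t, of 1] this] show ?thesis by simp
    qed
    ultimately show ?case by (intro bexI[of _ ?g] ballI)
  next
    case (add f g)
    then obtain f' g' where "f' \<in> jet_ring X \<sigma>" "g' \<in> jet_ring X \<sigma>"
      "\<forall>t\<in>I. (f has_field_derivative f' t) (at t within I)" "\<forall>t\<in>I. (g has_field_derivative g' t) (at t within I)"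
      by blast
    then show ?case
      by (intro bexI[of _ "\<lambda>t. f' t + g' t"]) (auto intro: jet_ring.intros DERIV_add)
  next
    case (mult f g)
    then obtain f' g' where "f' \<in> jet_ring X \<sigma>" "g' \<in> jet_ring X \<sigma>"
      "\<forall>t\<in>I. (f has_field_derivative f' t) (at t within I)" "\<forall>t\<in>I. (g has_field_derivative g' t) (at t within I)"
      by blast
    then show ?case using mult.hyps
      by (intro bexI[of _ "\<lambda>t. f' t * g t + g' t * f t"]) (auto intro: jet_ring.intros DERIV_mult)
  qed
  show ?thesis
  \<comment> \<open>\<open>\<sigma>\<close> is adjoined because the generators contain it only
    inside the \<open>X n\<close>.\<close>
  proof (rule smooth_on_interval_coinduct[of \<sigma> "insert \<sigma> (jet_ring X \<sigma>)"])
    fix f assume "f \<in> insert \<sigma> (jet_ring X \<sigma>)"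
    then have "\<exists>g\<in>jet_ring X \<sigma>. \<forall>t\<in>I. (f has_field_derivative g t) (at t within I)"
      using ring s \<sigma>' by blast
    then show "\<exists>g\<in>insert \<sigma> (jet_ring X \<sigma>). \<forall>t\<in>I. (f has_vector_derivative g t) (at t within I)"
      by (auto simp: has_real_derivative_iff_has_vector_derivative)
  qed simp
qed

section \<open>The abscissa as a coordinate and affine maps of the parabola\<close>

lemma inj_on_nonzero_derivative:
  fixes x :: "real \<Rightarrow> real"
  assumes I: "is_interval I"
    and x: "\<And>t. t \<in> I \<Longrightarrow> (x has_vector_derivative x' t) (at t within I)"
    and nz: "\<And>t. t \<in> I \<Longrightarrow> x' t \<noteq> 0"
  shows "inj_on x I"
proof (rule linorder_inj_onI)
  fix a b assume ab: "a < b" "a \<in> I" "b \<in> I"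
  have sub: "{a..b} \<subseteq> I" using mem_is_interval_1_I[OF I ab(2,3)] by auto
  have "\<exists>t\<in>{a<..<b}. x b - x a = (b - a) *\<^sub>R x' t"
  proof (rule mvt_simple[OF ab(1)])
    fix t assume "a \<le> t" "t \<le> b"
    then show "(x has_derivative (\<lambda>h. h *\<^sub>R x' t)) (at t within {a..b})"
      using x[of t] sub has_vector_derivative_within_subset[of x "x' t" t I "{a..b}"]
      by (auto simp: has_vector_derivative_def)
  qed
  then obtain t where "t \<in> {a<..<b}" "x b - x a = (b - a) *\<^sub>R x' t" by blast
  moreover from this have "x' t \<noteq> 0" using nz[of t] subsetD[OF sub, of t] by auto
  ultimately show "x a \<noteq> x b" using ab by auto
qed auto

text \<open>The affine map inducing \<open>x \<mapsto> \<alpha> x + \<beta>\<close> on the parabola \<open>y = c x\<^sup>2\<close>.\<close>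

lemma parabola_affine_extension:
  assumes v: "v \<noteq> 0" and \<alpha>: "\<alpha> \<noteq> 0"
  obtains F where "F \<in> Aff"
    "\<And>x. F (p + v * Complex x (c * x\<^sup>2)) = p + v * Complex (\<alpha> * x + \<beta>) (c * (\<alpha> * x + \<beta>)\<^sup>2)"
proof -
  \<comment> \<open>Expanding c (\<alpha> x + \<beta>)^2 and replacing c x^2 by y gives a triangular
    matrix with diagonal \<alpha>, \<alpha>^2; the constant terms enter the translation in
    \<open>F\<close>.\<close>
  define A where "A z = v * Complex (\<alpha> * Re (z / v)) (2 * \<alpha> * \<beta> * c * Re (z / v) + \<alpha>\<^sup>2 * Im (z / v))" for z
  have lin: "linear A"
  proof (rule linearI)
    show "A (y + z) = A y + A z" for y z
      by (simp add: A_def add_divide_distrib complex_eq_iff algebra_simps)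
    show "A (r *\<^sub>R z) = r *\<^sub>R A z" for r z
    proof -
      have "(r *\<^sub>R z) / v = r *\<^sub>R (z / v)" by (simp add: scaleR_conv_of_real)
      then show ?thesis by (simp only: A_def) (simp add: complex_eq_iff algebra_simps)
    qed
  qed
  have "inj A"
    unfolding linear_injective_0[OF lin]
  proof (intro allI impI)
    fix z assume "A z = 0"
    then have "Complex (\<alpha> * Re (z / v)) (2 * \<alpha> * \<beta> * c * Re (z / v) + \<alpha>\<^sup>2 * Im (z / v)) = 0"
      using v by (simp add: A_def)
    then have "z / v = 0" using \<alpha> by (auto simp: complex_eq_iff)
    then show "z = 0" using v by simp
  qed
  then have "bij A" using lin by (simp add: bij_def linear_injective_imp_surjective)
  define F where "F z = A z + (p + v * Complex \<beta> (c * \<beta>\<^sup>2) - A p)" for z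
  have "F \<in> Aff" using lin \<open>bij A\<close> F_def[abs_def] unfolding Aff_def by blast
  moreover have "F (p + v * Complex x (c * x\<^sup>2)) = p + v * Complex (\<alpha> * x + \<beta>) (c * (\<alpha> * x + \<beta>)\<^sup>2)" for x
  proof -
    have "F (p + v * Complex x (c * x\<^sup>2)) = p + (A (v * Complex x (c * x\<^sup>2)) + v * Complex \<beta> (c * \<beta>\<^sup>2))"
      by (simp add: F_def linear_add[OF lin])
    also have "A (v * Complex x (c * x\<^sup>2)) = v * Complex (\<alpha> * x) (2 * \<alpha> * \<beta> * c * x + \<alpha>\<^sup>2 * (c * x\<^sup>2))"
      using v by (simp add: A_def)
    also have "\<dots> + v * Complex \<beta> (c * \<beta>\<^sup>2) = v * Complex (\<alpha> * x + \<beta>) (c * (\<alpha> * x + \<beta>)\<^sup>2)"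
      unfolding distrib_left[symmetric]
      by (intro arg_cong[where f = "(*) v"]) (simp add: complex_eq_iff power2_eq_square algebra_simps)
    finally show ?thesis .
  qed
  ultimately show thesis using that by blast
qed

lemma line_or_parabola_imp_self_affine:
  assumes "curve I \<gamma>" and bdd: "bounded (\<gamma> ` I)" and v: "v \<noteq> 0"
    and sub: "\<gamma> ` I \<subseteq> range (\<lambda>x. p + v * Complex x (c * x\<^sup>2))"
  shows "harada_self_affine I \<gamma>"
proof -
  have I: "interval I" and intI: "is_interval I" using assms by (auto simp: curve_def interval_def)
  obtain D where D0: "\<And>t. t \<in> I \<Longrightarrow> D 0 t = \<gamma> t"
    and D: "\<And>n t. t \<in> I \<Longrightarrow> (D n has_vector_derivative D (Suc n) t) (at t within I)"
    and D1: "\<And>t. t \<in> I \<Longrightarrow> D 1 t \<noteq> 0"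
    using curve_derivatives[OF assms(1)] by blast
  \<comment> \<open>\<open>X n\<close> is the n-th derivative of the abscissa along
    \<open>v\<close>; the base point \<open>p\<close> is subtracted only at order 0 because it is
    constant.\<close>
  define X where "X n t = Re ((D n t - (if n = 0 then p else 0)) / v)" for n t
  have X: "(X n has_vector_derivative X (Suc n) t) (at t within I)" if "t \<in> I" for n t
  proof -
    have "((\<lambda>t. (D n t - (if n = 0 then p else 0)) / v) has_vector_derivative D (Suc n) t / v) (at t within I)"
      using D[OF that, of n] by (auto intro!: derivative_eq_intros)
    from bounded_linear.has_vector_derivative[OF bounded_linear_Re this]
    show ?thesis by (simp add: X_def[abs_def])
  qed
  have \<gamma>_eq: "\<gamma> t = p + v * Complex (X 0 t) (c * (X 0 t)\<^sup>2)" if t: "t \<in> I" for t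
  proof -
    obtain x where x: "\<gamma> t = p + v * Complex x (c * x\<^sup>2)" using sub t by blast
    then have "X 0 t = x" using v D0[OF t] by (simp add: X_def)
    then show ?thesis using x by simp
  qed
  \<comment> \<open>The curve is a polynomial in its abscissa, so a critical point of the abscissa
    would be a point of zero velocity.\<close>
  have X1: "X 1 t \<noteq> 0" if t: "t \<in> I" for t
  proof
    assume X1: "X 1 t = 0"
    have "((\<lambda>t. complex_of_real (X 0 t)) has_vector_derivative of_real (X 1 t)) (at t within I)"
      using bounded_linear.has_vector_derivative[OF bounded_linear_of_real X[OF t, of 0]] by simp
    then have x: "((\<lambda>t. complex_of_real (X 0 t)) has_vector_derivative 0) (at t within I)"
      using X1 by simp
    have "((\<lambda>t. p + v * (of_real (X 0 t) + \<i> * of_real c * (of_real (X 0 t))\<^sup>2)) has_vector_derivative 0) (at t within I)"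
      unfolding power2_eq_square by (rule derivative_eq_intros x | simp)+
    then have "(D 0 has_vector_derivative 0) (at t within I)"
    proof (rule has_vector_derivative_transform[OF t, rotated])
      fix t assume "t \<in> I"
      then show "D 0 t = p + v * (of_real (X 0 t) + \<i> * of_real c * (of_real (X 0 t))\<^sup>2)"
        using \<gamma>_eq D0 by (simp add: Complex_eq mult.assoc)
    qed
    moreover have "(D 0 has_vector_derivative D 1 t) (at t within I)" using D[OF t, of 0] by simp
    ultimately have "D 1 t = 0"
      using vector_derivative_unique_within[OF interval_at_within_nontrivial[OF I t]] by blast
    then show False using D1 t by blast
  qed
  define x where "x = X 0"
  have x': "(x has_vector_derivative X 1 t) (at t within I)" if "t \<in> I" for t
    using X[OF that, of 0] by (simp add: x_def)
  have inj: "inj_on x I" by (rule inj_on_nonzero_derivative[OF intI x' X1])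
  have cont: "continuous_on I x" using x' by (rule continuous_on_vector_derivative)
  \<comment> \<open>Boundedness is what makes homeomorphic intervals affinely equivalent: the real
    line and a bounded open interval are not.\<close>
  have bdd_x: "bounded (x ` I)"
  proof -
    have "x t = Re ((\<gamma> t - p) / v)" if "t \<in> I" for t using D0 that by (simp add: x_def X_def)
    then have "x ` I = (\<lambda>z. Re (z / v)) ` (+) (- p) ` \<gamma> ` I" by (auto simp: image_image)
    also have "bounded \<dots>"
      by (intro bounded_linear_image bounded_translation bdd bounded_linear_compose[OF bounded_linear_Re]
          bounded_linear_divide)
    finally show ?thesis .
  qed
  obtain y where y: "homeomorphism I (x ` I) x y"
    using homeomorphism_into_1d[OF is_interval_path_connected[OF intI] cont refl inj] by blast
  show ?thesis
    unfolding harada_self_affine_def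
  proof (intro allI impI, elim conjE)
    fix J assume J: "J \<subseteq> I" "interval J" "J homeomorphic I"
    have cont_J: "continuous_on J x" and inj_J: "inj_on x J"
      using J cont inj by (auto intro: continuous_on_subset inj_on_subset)
    have "x ` I homeomorphic x ` J"
      using interval_injective_image(2)[OF I cont inj] interval_injective_image(2)[OF J(2) cont_J inj_J] J(3)
      by (meson homeomorphic_sym homeomorphic_trans)
    then obtain \<alpha> \<beta> where \<alpha>: "\<alpha> \<noteq> 0" and img: "(\<lambda>s. \<alpha> * s + \<beta>) ` (x ` I) = x ` J"
      using affine_map_onto_homeomorphic_interval[OF interval_injective_image(1)[OF I cont inj] bdd_x
          interval_injective_image(1)[OF J(2) cont_J inj_J] bounded_subset[OF bdd_x image_mono[OF J(1)]]]
      by blast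
    \<comment> \<open>As \<open>y\<close> inverts the abscissa, \<open>\<sigma>\<close> is the
      affine map of abscissas read in the original parameter.\<close>
    define \<sigma> where "\<sigma> t = y (\<alpha> * x t + \<beta>)" for t
    have yx: "y (x t) = t" if "t \<in> I" for t using y that by (simp add: homeomorphism_def)
    have "\<sigma> ` I = y ` ((\<lambda>s. \<alpha> * s + \<beta>) ` (x ` I))" by (simp add: \<sigma>_def image_image)
    also have "\<dots> = J" unfolding img using J(1) yx by (force simp: image_image)
    finally have \<sigma>_img: "\<sigma> ` I = J" .
    have conj: "x (\<sigma> t) = \<alpha> * x t + \<beta>" if "t \<in> I" for t
    proof -
      have "\<alpha> * x t + \<beta> \<in> x ` J" using img that by blast
      then have "\<alpha> * x t + \<beta> \<in> x ` I" using J(1) by blast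
      then show ?thesis using homeomorphism_apply2[OF y] by (simp add: \<sigma>_def)
    qed
    have \<sigma>_inj: "inj_on \<sigma> I"
    proof (rule inj_onI)
      fix s t assume st: "s \<in> I" "t \<in> I" "\<sigma> s = \<sigma> t"
      then have "\<alpha> * x s + \<beta> = \<alpha> * x t + \<beta>" using conj by metis
      then show "s = t" using \<alpha> inj st by (auto simp: inj_on_def)
    qed
    have "(\<lambda>t. \<alpha> * x t + \<beta>) ` I \<subseteq> x ` I" using img J(1) by (auto simp: image_image)
    moreover have "continuous_on (x ` I) y" using y by (simp add: homeomorphism_def)
    ultimately have \<sigma>_cont: "continuous_on I \<sigma>"
      unfolding \<sigma>_def using cont
      by (intro continuous_on_compose2[of "x ` I" y I "\<lambda>t. \<alpha> * x t + \<beta>"] continuous_intros)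
    have "smooth_on_interval I \<sigma>"
      by (rule smooth_conjugate[of I X \<sigma> \<alpha> \<beta>])
        (use X X1 \<sigma>_img J(1) \<sigma>_cont \<sigma>_inj inj conj in \<open>auto simp: x_def\<close>)
    moreover have "\<exists>\<tau>. homeomorphism I J \<sigma> \<tau>"
      using homeomorphism_into_1d[OF is_interval_path_connected[OF intI] \<sigma>_cont \<sigma>_img \<sigma>_inj] by blast
    ultimately have rep: "reparametrization I J \<sigma>" by (simp add: reparametrization_def)
    obtain F where F: "F \<in> Aff"
      "\<And>s. F (p + v * Complex s (c * s\<^sup>2)) = p + v * Complex (\<alpha> * s + \<beta>) (c * (\<alpha> * s + \<beta>)\<^sup>2)"
      using parabola_affine_extension[OF v \<alpha>] by blast
    have "\<gamma> (\<sigma> t) = F (\<gamma> t)" if t: "t \<in> I" for t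
    proof -
      have "\<sigma> t \<in> I" using \<sigma>_img J(1) t by blast
      then show ?thesis using \<gamma>_eq conj[OF t] t F(2) by (simp add: x_def)
    qed
    then show "\<exists>\<sigma> F. reparametrization I J \<sigma> \<and> F \<in> Aff \<and> (\<forall>t\<in>I. \<gamma> (\<sigma> t) = F (\<gamma> t))"
      using rep F(1) by blast
  qed
qed

theorem theorem1p2:
  fixes I :: "real set" and \<gamma> :: "real \<Rightarrow> complex"
  assumes "curve I \<gamma>"
  shows "harada_self_affine I \<gamma> \<longleftrightarrow>
    bounded (\<gamma> ` I) \<and>
    ((\<exists>L. is_line L \<and> \<gamma> ` I \<subseteq> L) \<or> (\<exists>P. is_parabola P \<and> \<gamma> ` I \<subseteq> P))"
proof
  assume "harada_self_affine I \<gamma>"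
  then show "bounded (\<gamma> ` I) \<and>
    ((\<exists>L. is_line L \<and> \<gamma> ` I \<subseteq> L) \<or> (\<exists>P. is_parabola P \<and> \<gamma> ` I \<subseteq> P))"
    using self_affine_imp_line_or_parabola[OF assms] by blast
next
  assume R: "bounded (\<gamma> ` I) \<and>
    ((\<exists>L. is_line L \<and> \<gamma> ` I \<subseteq> L) \<or> (\<exists>P. is_parabola P \<and> \<gamma> ` I \<subseteq> P))"
  then obtain p v c where "v \<noteq> 0" "\<gamma> ` I \<subseteq> range (\<lambda>x. p + v * Complex x (c * x\<^sup>2))"
    using line_or_parabola_normal_form by metis
  then show "harada_self_affine I \<gamma>"
    using line_or_parabola_imp_self_affine[OF assms] R by blast
qed

end
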